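(* For all integers $n,i,j\ge 0$, the map $F=G\circ\psi^{-1}\circ\Phi\circ\varphi:\mathcal D(n)\to\mathcal D(n)$ (with $\varphi,\Phi,\psi^{-1},G$ the explicit maps defined in the context) restricts to a bijection $$F:\mathcal D_{i,j}(n)\longrightarrow \mathcal D'_{i,j}(n),$$ where $\mathcal D_{i,j}(n)=\{\lambda\in\mathcal D(n): e_1(\lambda)=i,\ e_3(\lambda)=j\}$ and $\mathcal D'_{i,j}(n)=\{\sigma\in\mathcal D(n): r_1(\sigma)=i,\ r_3(\sigma)=j\}$. In particular, $|\mathcal D_{i,j}(n)|=|\mathcal D'_{i,j}(n)|$; that is, the number of strict partitions $\lambda$ of $n$ with $e_1(\lambda)=i$ and $e_3(\lambda)=j$ equals the number of strict partitions $\sigma$ of $n$ with $r_1(\sigma)=i$ and $r_3(\sigma)=j$.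
   Context: A partition $\lambda$ of $n$ is a weakly decreasing finite sequence of positive integers $\lambda_1\ge\lambda_2\ge\cdots\ge\lambda_\ell$ with sum $n$ (the empty partition is the partition of $0$); $\ell(\lambda)=\ell$ is its number of parts, $|\lambda|=n$ its sum, and $\mathrm{mult}_\lambda(m)$ the number of parts equal to $m$. It is strict if its parts are distinct. Statistics. For a strict partition $\lambda=(\lambda_1>\cdots>\lambda_\ell)$, $e_1(\lambda)$ is the number of indices $r$ with $1\le r\le\ell$, $\lambda_r$ odd and $r$ odd; $e_3(\lambda)$ is the number of indices $r$ with $1\le r\le\ell$, $\lambda_r$ odd and $r$ even. For any partition $\lambda$ and $a\in\{1,3\}$, $r_a(\lambda)$ is the number of indices $s$ with $\lambda_s\equiv a\pmod 4$ (parts counted with multiplicity). Classes. $\mathcal D(n)$: strict partitions of $n$. $\mathcal O(n)$: partitions of $n$ into odd parts. $\mathcal A_1(n)$: partitions $\alpha=(\alpha_1\ge\cdots\ge\alpha_s)$ of $n$ such that (A1.1) only even parts may be repeated; (A1.2) $\alpha_r-\alpha_{r+1}\le4$ for $1\le r<s$; (A1.3) for $1\le r<s$, $\alpha_r-\alpha_{r+1}<4$ if $\alpha_r$ or $\alpha_{r+1}$ is even; (A1.4) $\alpha_s<4$ if $\alpha$ is nonempty. $\mathcal A_2(n)$: partitions of $n$ such that (A2.1) no part is divisible by $4$; (A2.2) only even parts may be repeated. Map $\varphi:\mathcal D(n)\to\mathcal A_1(n)$. The $2$-modular diagram of $\lambda\in\mathcal D(n)$ is the left-justified array with one row per part (row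 $r$ for $\lambda_r$): a part $2q$ gives a row of $q$ entries equal to $2$; a part $2q+1$ gives $q$ entries equal to $2$ followed by a single entry $1$. Then $\varphi(\lambda)$ is the sequence of column sums, read left to right. (It is known that $\varphi(\lambda)\in\mathcal A_1(n)$.) Map $\Phi:\mathcal A_1(n)\to\mathcal A_2(n)$. Given $\alpha\in\mathcal A_1(n)$, run the following algorithm on a current partition, initially $\alpha$, always kept in weakly decreasing order ("reorder" means re-sort into weakly decreasing order), with a list $\delta$ of recorded positive multiples of $4$, initially empty. Extraction (i), pre-extraction. Call a part $\alpha_j$ of the current partition removable if it is divisible by $4$ and either $\alpha_j$ is the largest part, or $\alpha_j$ is an interior part (neither first nor last) and its neighbours satisfy $\alpha_{j-1}-\alpha_{j+1}\le4$, with strict inequality if either of $\alpha_{j-1},\alpha_{j+1}$ is even. While some part is removable, delete the largest removable part (the leftmost such part if that value is repeated) and record its value, unchanged, as a part of $\delta$. Extraction (ii), iterative extraction. While the current partition contains a multiple of $4$, take the largest such part; say it occupies position $s$ (counting from the largest part) and equals $4m$. Subtract $4$ from each of the $s-1$ parts preceding it, delete the part $4m$, reorder, and record $4(s-1)+4m$ as a part of $\delta$. Insertion. Insert the recorded parts of $\delta$ one at a time in weakly decreasing order into the current partition: to insert $4h$, add $4$ to each of the first $h$ parts of the current partition and reorder. The final partition is $\Phi(\alpha)$. (It is known that the algorithm is well defined, i.e. all parts stay positive and each inserted $4h$ has $h$ at most the number of parts, and that $\Phi(\alpha)\in\mathcal A_2(n)$.) Map $\psi^{-1}:\mathcal A_2(n)\to\mathcal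 O(n)$. For $\beta\in\mathcal A_2(n)$ and each odd positive integer $m$ let $b_m,b_{2m}$ be the multiplicities of $m$ and $2m$ in $\beta$. Then $\mu=\psi^{-1}(\beta)$ is the partition into odd parts with $\mathrm{mult}_\mu(m)=b_m+2b_{2m}$ for every odd $m$. Map $G:\mathcal O(n)\to\mathcal D(n)$ (Glaisher's map). For $\mu\in\mathcal O(n)$ and each odd $m$ write $\mathrm{mult}_\mu(m)=\sum_{c\ge0}\epsilon_{m,c}2^c$ with $\epsilon_{m,c}\in\{0,1\}$, and replace the copies of $m$ by the parts $2^cm$ for those $c$ with $\epsilon_{m,c}=1$; the resulting strict partition is $G(\mu)$. *)

theory Defs
  imports Main
begin

text \<open>Partitions are weakly decreasing lists of positive natural numbers.\<close>

definition is_partition :: "nat list \<Rightarrow> bool" where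
  "is_partition xs \<longleftrightarrow> sorted_wrt (\<ge>) xs \<and> (\<forall>x\<in>set xs. 0 < x)"

definition partitions :: "nat \<Rightarrow> nat list set" where
  "partitions n = {xs. is_partition xs \<and> sum_list xs = n}"

definition reorder :: "nat list \<Rightarrow> nat list" where
  "reorder xs = rev (sort xs)"

text \<open>The classes \<open>\<D>(n)\<close>, \<open>\<O>(n)\<close>, \<open>\<A>\<^sub>1(n)\<close> and \<open>\<A>\<^sub>2(n)\<close>. The last three are the
  intermediate classes through which the bijection passes; the maps below are total functions on
  lists, and only their values on these classes are meaningful.\<close>

definition strict_partitions :: "nat \<Rightarrow> nat list set" where
  "strict_partitions n = {xs \<in> partitions n. distinct xs}"

definition odd_partitions :: "nat \<Rightarrow> nat list set" where
  "odd_partitions n = {xs \<in> partitions n. \<forall>x\<in>set xs. odd x}"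

definition only_even_repeated :: "nat list \<Rightarrow> bool" where
  "only_even_repeated xs \<longleftrightarrow> (\<forall>x. 1 < count_list xs x \<longrightarrow> even x)"

definition A1_partitions :: "nat \<Rightarrow> nat list set" where
  "A1_partitions n = {xs \<in> partitions n.
     only_even_repeated xs \<and>
     (\<forall>r. Suc r < length xs \<longrightarrow> xs ! r - xs ! Suc r \<le> 4) \<and>
     (\<forall>r. Suc r < length xs \<longrightarrow> even (xs ! r) \<or> even (xs ! Suc r) \<longrightarrow> xs ! r - xs ! Suc r < 4) \<and>
     (xs \<noteq> [] \<longrightarrow> last xs < 4)}"

definition A2_partitions :: "nat \<Rightarrow> nat list set" where
  "A2_partitions n = {xs \<in> partitions n. (\<forall>x\<in>set xs. \<not> 4 dvd x) \<and> only_even_repeated xs}"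

text \<open>Statistics. The index \<open>r\<close> in \<open>e1\<close> and \<open>e3\<close> is 1-based, since its parity matters.\<close>

definition e1 :: "nat list \<Rightarrow> nat" where
  "e1 xs = card {r. 1 \<le> r \<and> r \<le> length xs \<and> odd (xs ! (r - 1)) \<and> odd r}"

definition e3 :: "nat list \<Rightarrow> nat" where
  "e3 xs = card {r. 1 \<le> r \<and> r \<le> length xs \<and> odd (xs ! (r - 1)) \<and> even r}"

definition residue_count :: "nat \<Rightarrow> nat list \<Rightarrow> nat" where
  "residue_count a xs = card {s. s < length xs \<and> xs ! s mod 4 = a mod 4}"

definition D_e :: "nat \<Rightarrow> nat \<Rightarrow> nat \<Rightarrow> nat list set" where
  "D_e n i j = {xs \<in> strict_partitions n. e1 xs = i \<and> e3 xs = j}"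

definition D_r :: "nat \<Rightarrow> nat \<Rightarrow> nat \<Rightarrow> nat list set" where
  "D_r n i j = {xs \<in> strict_partitions n. residue_count 1 xs = i \<and> residue_count 3 xs = j}"

text \<open>The map \<open>\<phi>\<close>. The library function \<open>transpose\<close> reads off the columns of a left-justified
  array with rows of unequal length.\<close>

definition two_modular_row :: "nat \<Rightarrow> nat list" where
  "two_modular_row k = replicate (k div 2) 2 @ replicate (k mod 2) 1"

definition phi_map :: "nat list \<Rightarrow> nat list" where
  "phi_map xs = map sum_list (transpose (map two_modular_row xs))"

text \<open>The map \<open>\<Phi>\<close>. List positions are 0-based here. In a weakly decreasing list the first position
  satisfying a condition holds the largest part satisfying it, and it is the leftmost such part.\<close>

definition delete_at :: "nat \<Rightarrow> nat list \<Rightarrow> nat list" where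
  "delete_at j xs = take j xs @ drop (Suc j) xs"

definition removable :: "nat list \<Rightarrow> nat \<Rightarrow> bool" where
  "removable xs j \<longleftrightarrow> j < length xs \<and> 4 dvd xs ! j \<and>
     (xs ! j = Max (set xs) \<or>
      (0 < j \<and> Suc j < length xs \<and>
       xs ! (j - 1) - xs ! Suc j \<le> 4 \<and>
       (even (xs ! (j - 1)) \<or> even (xs ! Suc j) \<longrightarrow> xs ! (j - 1) - xs ! Suc j < 4)))"

function pre_extract :: "nat list \<Rightarrow> nat list \<Rightarrow> nat list \<times> nat list" where
  "pre_extract xs ds =
     (case find (removable xs) [0..<length xs] of
        None \<Rightarrow> (xs, ds)
      | Some j \<Rightarrow> pre_extract (delete_at j xs) (ds @ [xs ! j]))"
  by pat_completeness auto
termination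
  by (relation "measure (\<lambda>(xs, ds). length xs)") (auto simp: find_Some_iff delete_at_def)

declare pre_extract.simps [simp del]

text \<open>With \<open>j\<close> 0-based, \<open>j\<close> is the number \<open>s - 1\<close> of parts preceding the extracted part. Those parts
  exceed a positive multiple of 4, so the subtraction does not truncate and leaves them positive.\<close>

function iter_extract :: "nat list \<Rightarrow> nat list \<Rightarrow> nat list \<times> nat list" where
  "iter_extract xs ds =
     (case find (\<lambda>j. 4 dvd xs ! j) [0..<length xs] of
        None \<Rightarrow> (xs, ds)
      | Some j \<Rightarrow>
          iter_extract (reorder (map (\<lambda>x. x - 4) (take j xs) @ drop (Suc j) xs))
            (ds @ [4 * j + xs ! j]))"
  by pat_completeness auto
termination
  by (relation "measure (\<lambda>(xs, ds). length xs)") (auto simp: find_Some_iff reorder_def)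

declare iter_extract.simps [simp del]

text \<open>Insertion of \<open>d = 4 * h\<close>; on \<open>\<A>\<^sub>1(n)\<close> the algorithm always has \<open>h \<le> length xs\<close>.\<close>

definition insert_part :: "nat \<Rightarrow> nat list \<Rightarrow> nat list" where
  "insert_part d xs =
     (let h = d div 4 in reorder (map (\<lambda>x. x + 4) (take h xs) @ drop h xs))"

definition Phi_map :: "nat list \<Rightarrow> nat list" where
  "Phi_map xs =
     (let (ys, ds) = pre_extract xs [];
          (zs, ds') = iter_extract ys ds
      in fold insert_part (reorder ds') zs)"

text \<open>The map \<open>\<psi>\<^sup>-\<^sup>1\<close>: every \<open>m\<close> with \<open>b\<^sub>m\<close> or \<open>b\<^sub>2\<^sub>m\<close> nonzero is at most \<open>sum_list xs\<close>, so the
  bound on \<open>m\<close> is harmless.\<close>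

definition psi_inv :: "nat list \<Rightarrow> nat list" where
  "psi_inv xs =
     concat (map (\<lambda>m. replicate (count_list xs m + 2 * count_list xs (2 * m)) m)
       (filter odd (rev [0..<Suc (sum_list xs)])))"

text \<open>The map \<open>G\<close>: \<open>bit k c\<close> is the binary digit \<open>\<epsilon>\<^sub>c\<close> of \<open>k\<close>, and it vanishes for \<open>c \<ge> k\<close>
  because \<open>k < 2 ^ k\<close>.\<close>

definition glaisher :: "nat list \<Rightarrow> nat list" where
  "glaisher xs =
     reorder [2 ^ c * m. m \<leftarrow> [0..<Suc (sum_list xs)], odd m,
                         c \<leftarrow> [0..<count_list xs m], bit (count_list xs m) c]"

definition F_map :: "nat list \<Rightarrow> nat list" where
  "F_map = glaisher \<circ> psi_inv \<circ> Phi_map \<circ> phi_map"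

end

theory Submission
  imports Defs "HOL-Library.Multiset"
begin

text \<open>The set \<open>\<D>(n)\<close> is finite and the map \<open>F\<close> sends it to itself, so \<open>F\<close> permutes it as soon as
  it is injective. If moreover \<open>r\<^sub>1(F(\<lambda>)) = e\<^sub>1(\<lambda>)\<close> and \<open>r\<^sub>3(F(\<lambda>)) = e\<^sub>3(\<lambda>)\<close>, this permutation
  restricts to the claimed bijections. Injectivity and the behaviour of the statistics are checked
  for each factor of \<open>F\<close>.

  The column sums of the 2-modular diagram of \<open>\<lambda>\<close> form a partition in \<open>\<A>\<^sub>1(n)\<close>. Their consecutive
  differences and parities determine \<open>\<lambda>\<close> (\<open>strict_phi_map_inject\<close>), and an odd part in position \<open>r\<close>
  produces the column sum \<open>2 * r - 1\<close>, which turns \<open>e\<^sub>1\<close>, \<open>e\<^sub>3\<close> into the residue counts mod 4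
  (\<open>residue_count_phi_map\<close>). At the other end, a partition in \<open>\<A>\<^sub>2(n)\<close> and its image under
  \<open>G \<circ> \<psi>\<^sup>-\<^sup>1\<close> have the same odd parts, and the binary digits of \<open>b\<^sub>m + 2 * b\<^sub>2\<^sub>m\<close> determine the
  multiplicities (\<open>glaisher_psi_inv_inject\<close>).

  The map \<open>\<Phi>\<close> changes parts by multiples of 4 and deletes multiples of 4, so it keeps the residue
  counts. For its injectivity, let \<open>\<xi>\<close> be what pre-extraction leaves of \<open>\<alpha>\<close>. As a multiset, \<open>\<alpha>\<close> is
  the union of \<open>\<xi>\<close> and the pre-extracted parts. In \<open>\<xi>\<close>, multiples of 4 are isolated, and each
  extraction closes the wide gap around one of them, so that no re-sorting ever takes place. The
  extraction therefore has a closed form: it produces a core, which is again a tight chain but has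
  no multiples of 4, and a list of lifted parts (\<open>iter_extract_eq\<close>). Insertion then adds columns of
  4s to the core. All of this can be undone:

  The residues mod 4 of \<open>\<Phi>(\<alpha>)\<close> are those of the core and determine it
  (\<open>tight_chain_residue_inject\<close>). The difference between \<open>\<Phi>(\<alpha>)\<close> and the core gives the multiset of
  recorded parts (\<open>mset_eq_if_level_counts\<close>). If \<open>t\<close> of them are lifted and \<open>m\<close> is the largest core
  part, then the lifted parts exceed \<open>m + 4 * t\<close> and the pre-extracted ones are less than
  \<open>m + 4 * t + 4\<close>; only one \<open>t\<close> can satisfy this, and it identifies the lifted parts as the \<open>t\<close>
  largest ones (\<open>recorded_parts_split\<close>). Finally, core and lifted parts determine \<open>\<xi>\<close>, part by part
  from the top (\<open>core_lifted_inject\<close>).\<close>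

section \<open>Chains with small gaps\<close>

text \<open>The relation between neighbours \<open>x\<close>, \<open>y\<close> in \<open>\<A>\<^sub>1\<close>. For \<open>x \<ge> y\<close> it is also the condition
  under which a multiple of 4 between \<open>x\<close> and \<open>y\<close> is removable.\<close>

definition small_gap :: "nat \<Rightarrow> nat \<Rightarrow> bool" where
  "small_gap x y \<longleftrightarrow>
     y \<le> x \<and> x \<le> y + 4 \<and> (even x \<or> even y \<longrightarrow> x < y + 4) \<and> (odd x \<longrightarrow> x \<noteq> y)"

text \<open>Membership in \<open>\<A>\<^sub>1(n)\<close> without the condition on the sum. Comparing neighbours suffices
  because the list decreases, and the bound on the last part says that it has a small gap to a
  part 0 behind it.\<close>

fun tight_chain :: "nat list \<Rightarrow> bool" where
  "tight_chain [] = True"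
| "tight_chain [x] = (0 < x \<and> x < 4)"
| "tight_chain (x # y # zs) = (small_gap x y \<and> tight_chain (y # zs))"

text \<open>Only the interior multiples of 4 are excluded here; a multiple of 4 at the head stays allowed.
  This makes suffixes of reduced lists reduced, as structural induction requires.\<close>

fun reduced :: "nat list \<Rightarrow> bool" where
  "reduced (w # x # y # zs) = ((4 dvd x \<longrightarrow> \<not> small_gap w y) \<and> reduced (x # y # zs))"
| "reduced _ = True"

text \<open>Weak decrease in which only even parts may be repeated.\<close>

abbreviation descends :: "nat \<Rightarrow> nat \<Rightarrow> bool" where
  "descends x y \<equiv> y \<le> x \<and> (odd x \<longrightarrow> x \<noteq> y)"

lemma tight_chain_ConsD: "tight_chain (x # xs) \<Longrightarrow> tight_chain xs"
  by (cases xs) auto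

lemma reduced_ConsD: "reduced (x # xs) \<Longrightarrow> reduced xs"
  by (cases "x # xs" rule: reduced.cases) auto

lemma tight_chain_positive: "tight_chain xs \<Longrightarrow> x \<in> set xs \<Longrightarrow> 0 < x"
proof (induction xs arbitrary: x rule: tight_chain.induct)
  case (3 u v zs)
  have "0 < v" using 3 by simp
  then have "0 < u" using 3(2) by (auto simp: small_gap_def)
  then show ?case using 3 by auto
qed auto

lemma tight_chain_descends: "tight_chain xs \<Longrightarrow> sorted_wrt descends xs"
proof (induction xs rule: tight_chain.induct)
  case (3 x y zs)
  then have "sorted_wrt descends (y # zs)" "small_gap x y" by auto
  then show ?case by (fastforce simp: small_gap_def)
qed auto

lemma sorted_desc_if_descends: "sorted_wrt descends xs \<Longrightarrow> sorted_wrt (\<ge>) xs"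
  by (erule sorted_wrt_mono_rel[rotated]) auto

lemma mset_reorder [simp]: "mset (reorder xs) = mset xs"
  by (simp add: reorder_def)

lemma set_reorder [simp]: "set (reorder xs) = set xs"
  by (simp add: reorder_def)

lemma sum_list_reorder [simp]: "sum_list (reorder xs) = sum_list xs"
  by (metis mset_reorder sum_mset_sum_list)

lemma sorted_reorder: "sorted_wrt (\<ge>) (reorder xs)"
  by (simp add: reorder_def sorted_wrt_rev)

lemma sorted_desc_eqI:
  fixes xs ys :: "nat list"
  assumes "sorted_wrt (\<ge>) xs" "sorted_wrt (\<ge>) ys" "mset xs = mset ys"
  shows "xs = ys"
proof -
  have "sorted (rev xs)" "sorted (rev ys)" using assms by (auto simp: sorted_wrt_rev)
  then have "rev xs = rev ys" using assms(3) by (metis mset_rev properties_for_sort)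
  then show ?thesis by simp
qed

lemma reorder_id: "sorted_wrt (\<ge>) xs \<Longrightarrow> reorder xs = xs"
  by (rule sorted_desc_eqI) (auto simp: sorted_reorder)

section \<open>Pre-extraction\<close>

text \<open>A part whose neighbours have a small gap can be deleted inside \<open>\<A>\<^sub>1\<close>; this is why
  pre-extraction does not leave the class.\<close>

lemma tight_chain_delete:
  "tight_chain (us @ w # x # y # vs) \<Longrightarrow> small_gap w y \<Longrightarrow> tight_chain (us @ w # y # vs)"
proof (induction us)
  case (Cons u us)
  then show ?case by (cases us) auto
qed auto

lemma reducedI:
  assumes "\<And>j. 0 < j \<Longrightarrow> Suc j < length xs \<Longrightarrow> 4 dvd xs ! j \<Longrightarrow>
             \<not> small_gap (xs ! (j - 1)) (xs ! Suc j)"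
  shows "reduced xs"
  using assms
proof (induction xs rule: reduced.induct)
  case (1 w x y zs)
  have "4 dvd x \<longrightarrow> \<not> small_gap w y"
    using 1(2)[of 1] by simp
  moreover have "reduced (x # y # zs)"
  proof (rule 1(1))
    fix j assume "0 < j" "Suc j < length (x # y # zs)" "4 dvd (x # y # zs) ! j"
    then show "\<not> small_gap ((x # y # zs) ! (j - 1)) ((x # y # zs) ! Suc j)"
      using 1(2)[of "Suc j"] by (cases j) auto
  qed
  ultimately show ?case by simp
qed auto

lemma removable_first:
  assumes "sorted_wrt (\<ge>) xs" "xs \<noteq> []" "4 dvd hd xs"
  shows "removable xs 0"
proof -
  have "Max (set xs) = hd xs"
    using assms by (cases xs) (auto intro!: Max_eqI)
  then show ?thesis using assms by (simp add: removable_def hd_conv_nth)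
qed

lemma removable_interior:
  assumes ch: "tight_chain xs" and rem: "removable xs j" and j: "0 < j" "\<not> removable xs 0"
  shows "Suc j < length xs \<and> small_gap (xs ! (j - 1)) (xs ! Suc j)"
proof -
  have desc: "sorted_wrt descends xs" by (rule tight_chain_descends[OF ch])
  have srt: "sorted_wrt (\<ge>) xs" by (rule sorted_desc_if_descends[OF desc])
  have jl: "j < length xs" and d4: "4 dvd xs ! j" using rem by (auto simp: removable_def)
  have "xs ! j \<noteq> Max (set xs)"
  proof
    assume eq: "xs ! j = Max (set xs)"
    have "xs ! 0 \<le> Max (set xs)" using jl by (intro Max_ge) (auto intro!: nth_mem)
    moreover have "xs ! j \<le> xs ! 0" using srt j jl by (auto simp: sorted_wrt_iff_nth_less)
    ultimately have "xs ! 0 = xs ! j" using eq by simp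
    then show False using j(2) d4 eq jl by (auto simp: removable_def)
  qed
  then have int: "Suc j < length xs" "xs ! (j - 1) - xs ! Suc j \<le> 4"
    "even (xs ! (j - 1)) \<or> even (xs ! Suc j) \<longrightarrow> xs ! (j - 1) - xs ! Suc j < 4"
    using rem by (auto simp: removable_def)
  have "descends (xs ! (j - 1)) (xs ! j)" "descends (xs ! j) (xs ! Suc j)"
    using desc j int(1) by (auto simp: sorted_wrt_iff_nth_less)
  then show ?thesis using int d4 by (auto simp: small_gap_def)
qed

text \<open>The last conjunct serves to bound the recorded values in terms of the current head: if the
  head \<open>x\<close> is deleted, the next part exceeds \<open>x - 4\<close>, and a multiple of 4 below \<open>x + 4\<close> is at most \<open>x\<close>. So the bound passes
  from the old head to the new one. The appended 0 serves as the head of an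
  empty list.\<close>

lemma delete_removable:
  assumes ch: "tight_chain xs" and rem: "removable xs j" and first: "\<forall>i<j. \<not> removable xs i"
  shows "tight_chain (delete_at j xs) \<and> mset xs = add_mset (xs ! j) (mset (delete_at j xs)) \<and>
    (\<forall>d. 4 dvd d \<and> d < hd (xs @ [0]) + 4 \<longrightarrow> d < hd (delete_at j xs @ [0]) + 4)"
proof -
  have jl: "j < length xs" and d4: "4 dvd xs ! j" using rem by (auto simp: removable_def)
  have split: "xs = take j xs @ xs ! j # drop (Suc j) xs" using jl by (rule id_take_nth_drop)
  have ms: "mset xs = add_mset (xs ! j) (mset (delete_at j xs))"
    by (subst split) (simp add: delete_at_def)
  show ?thesis
  proof (cases "j = 0")
    case True
    then obtain x rest where xs: "xs = x # rest" using jl by (cases xs) auto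
    have x4: "4 dvd x" "0 < x" using d4 True xs tight_chain_positive[OF ch] by auto
    then obtain y zs where rest: "rest = y # zs"
      using ch xs by (cases rest) (auto dest: dvd_imp_le)
    have gap: "small_gap x y" using ch xs rest by simp
    have "d < y + 4" if "4 dvd d" "d < x + 4" for d
      proof -
      have "x < y + 4" using gap x4 by (auto simp: small_gap_def)
      then show ?thesis using that x4 by presburger
    qed
    then show ?thesis using ms True xs rest ch by (auto simp: delete_at_def)
  next
    case False
    then obtain i where i: "j = Suc i" by (cases j) auto
    have int: "Suc j < length xs" "small_gap (xs ! i) (xs ! Suc j)"
      using removable_interior[OF ch rem] first False i by auto
    have xs: "xs = take i xs @ xs ! i # xs ! j # xs ! Suc j # drop (Suc (Suc j)) xs"
      using int(1) i by (simp add: Cons_nth_drop_Suc)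
    have del: "delete_at j xs = take i xs @ xs ! i # xs ! Suc j # drop (Suc (Suc j)) xs"
      using int(1) i by (simp add: delete_at_def Cons_nth_drop_Suc take_Suc_conv_app_nth)
    have "tight_chain (delete_at j xs)"
      unfolding del using xs ch int(2) by (metis tight_chain_delete)
    moreover have "hd (delete_at j xs @ [0]) = hd (xs @ [0])"
      using i jl by (cases xs) (auto simp: delete_at_def)
    ultimately show ?thesis using ms by simp
  qed
qed

text \<open>Pre-extraction records values unchanged, so the multiset union of remaining and recorded parts is
  constant, and the input can be read off from the output without replaying the order of deletion.\<close>

lemma pre_extract_spec:
  assumes "pre_extract xs ds = (ys, es)" "tight_chain xs"
    "\<forall>d\<in>set ds. 4 dvd d \<and> d < hd (xs @ [0]) + 4"
  shows "tight_chain ys \<and> reduced ys \<and> (ys = [] \<or> \<not> 4 dvd hd ys) \<and>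
    mset ys + mset es = mset xs + mset ds \<and> (\<forall>d\<in>set es. 4 dvd d \<and> d < hd (ys @ [0]) + 4)"
  using assms
proof (induction xs ds rule: pre_extract.induct)
  case (1 xs ds)
  show ?case
  proof (cases "find (removable xs) [0..<length xs]")
    case None
    then have eq: "ys = xs" "es = ds" using 1(2) by (auto simp: pre_extract.simps[of xs])
    have no: "\<not> removable xs j" if "j < length xs" for j
      using None that by (auto simp: find_None_iff)
    have srt: "sorted_wrt (\<ge>) xs"
      by (intro sorted_desc_if_descends tight_chain_descends 1(3))
    have "reduced xs"
    proof (rule reducedI)
      fix j assume j: "0 < j" "Suc j < length xs" "4 dvd xs ! j"
      then have "\<not> removable xs j" using no by simp
      then have "\<not> (xs ! (j - 1) - xs ! Suc j \<le> 4 \<and>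
        (even (xs ! (j - 1)) \<or> even (xs ! Suc j) \<longrightarrow> xs ! (j - 1) - xs ! Suc j < 4))"
        using j unfolding removable_def by simp
      then show "\<not> small_gap (xs ! (j - 1)) (xs ! Suc j)"
        unfolding small_gap_def by linarith
    qed
    moreover have "xs = [] \<or> \<not> 4 dvd hd xs"
      using no[of 0] removable_first[OF srt] by auto
    ultimately show ?thesis using eq 1(3,4) by simp
  next
    case (Some j)
    then have j: "removable xs j" "\<forall>i<j. \<not> removable xs i"
      by (auto simp: find_Some_iff) 
    note del = delete_removable[OF 1(3) j]
    have d4: "4 dvd xs ! j" and jl: "j < length xs" using j by (auto simp: removable_def)
    have "xs ! j \<le> hd (xs @ [0])"
      using sorted_desc_if_descends[OF tight_chain_descends[OF 1(3)]] jl
      by (cases xs) (auto simp: nth_Cons split: nat.splits)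
    then have "\<forall>d\<in>set (ds @ [xs ! j]). 4 dvd d \<and> d < hd (delete_at j xs @ [0]) + 4"
      using 1(4) d4 del by auto
    moreover have "pre_extract (delete_at j xs) (ds @ [xs ! j]) = (ys, es)"
      using 1(2) Some by (simp add: pre_extract.simps[of xs])
    ultimately have "tight_chain ys \<and> reduced ys \<and> (ys = [] \<or> \<not> 4 dvd hd ys) \<and>
      mset ys + mset es = mset (delete_at j xs) + mset (ds @ [xs ! j]) \<and>
      (\<forall>d\<in>set es. 4 dvd d \<and> d < hd (ys @ [0]) + 4)"
      using 1(1)[OF Some] del by blast
    then show ?thesis using del by simp
  qed
qed

section \<open>Iterative extraction\<close>

text \<open>Iterative extraction in closed form. The larger multiples of 4 leave first, so when \<open>4 * m\<close>
  is extracted, the parts before it are exactly those earlier parts that are not divisible by 4;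
  each of them loses 4, and the recorded value gains 4 for each of them. Hence a part not divisible
  by 4 loses 4 for every multiple of 4 behind it (what remains is the core), and a multiple of 4
  gains 4 for every part not divisible by 4 in front of it (these are the lifted parts).\<close>

fun core :: "nat list \<Rightarrow> nat list" and lifted :: "nat list \<Rightarrow> nat list" where
  "core [] = []"
| "core (x # xs) = (if 4 dvd x then core xs else (x - 4 * length (lifted xs)) # core xs)"
| "lifted [] = []"
| "lifted (x # xs) = (if 4 dvd x then x # lifted xs else map ((+) 4) (lifted xs))"

text \<open>Two neighbouring multiples of 4 with a small gap are equal, and then the second copy would be
  removable because its two neighbours already have a small gap.\<close>

lemma multiple_not_adjacent:
  assumes "tight_chain (x # xs)" "reduced (x # xs)" "4 dvd x"
  obtains y zs where "xs = y # zs" "\<not> 4 dvd y" "y < x" "x < y + 4"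
proof -
  have "0 < x" using assms(1) tight_chain_positive by auto
  then obtain y zs where xs: "xs = y # zs"
    using assms by (cases xs) (auto dest: dvd_imp_le)
  have gap: "small_gap x y" using assms(1) xs by simp
  have y: "\<not> 4 dvd y"
  proof
    assume d: "4 dvd y"
    then have eq: "y = x" using gap assms(3) by (auto simp: small_gap_def elim!: dvdE)
    obtain z vs where "zs = z # vs"
      using assms(1) xs eq assms(3) \<open>0 < x\<close> by (cases zs) (auto dest: dvd_imp_le)
    then show False using assms xs eq by auto
  qed
  then have "y < x" "x < y + 4"
    using gap assms(3) by (auto simp: small_gap_def le_less)
  then show ?thesis using that xs y by blast
qed

text \<open>Going down by one part not divisible by 4 lowers the value by at most 4 and raises the lift of all
  later multiples by 4, so no lifted part drops below the head, and the lifted parts increase in the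
  order of extraction. The same count from below bounds them by 4 times the number of core parts,
  which is what makes the later insertion of these parts possible.\<close>

lemma lifted_bounds:
  assumes "tight_chain (x # xs)" "reduced (x # xs)"
  shows "(\<forall>h\<in>set (lifted (x # xs)). 4 dvd h \<and> x \<le> h \<and> h \<le> 4 * length (core (x # xs))) \<and>
    (\<not> 4 dvd x \<longrightarrow> x < 4 * length (core (x # xs))) \<and> sorted (lifted (x # xs))"
  using assms
proof (induction xs arbitrary: x)
  case Nil
  then show ?case by (auto dest: dvd_imp_le)
next
  case (Cons y zs)
  have red: "reduced (y # zs)" by (rule reduced_ConsD[OF Cons.prems(2)])
  have gap: "small_gap x y" and ch: "tight_chain (y # zs)" using Cons.prems(1) by auto
  define C L where "C = core (y # zs)" and "L = lifted (y # zs)"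
  note IH = Cons.IH[OF ch red, folded C_def L_def]
  show ?case
  proof (cases "4 dvd x")
    case True
    then have y: "\<not> 4 dvd y" "y < x" "x < y + 4"
      using multiple_not_adjacent[OF Cons.prems] by auto
    have ge: "x \<le> h" if "h \<in> set (L)" for h
    proof -
      have "4 dvd h" "y \<le> h" using IH that by blast+
      then show ?thesis using True y by presburger
    qed
    have "y < 4 * length (C)" using IH y by blast
    then have "x \<le> 4 * length (C)"
      using y True by presburger
    moreover have "core (x # y # zs) = C" "lifted (x # y # zs) = x # L"
      using True by (simp_all add: C_def L_def)
    ultimately show ?thesis using IH True ge by auto
  next
    case False
    have bound: "y \<le> 4 * length (C)"
    proof (cases "4 dvd y")
      case True
      then have "y \<in> set L" by (simp add: L_def)
      then show ?thesis using IH by blast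
    qed (use IH in auto)
    have "x < 4 * Suc (length (C))"
    proof (cases "4 dvd y")
      case True
      then have "x < y + 4" using gap by (auto simp: small_gap_def)
      then show ?thesis using bound by simp
    next
      case False
      then show ?thesis using IH gap by (simp add: small_gap_def)
    qed
    moreover have "sorted (map ((+) 4) (L))"
      using IH by (simp add: sorted_wrt_map)
    moreover have "x \<le> 4 + h" if "h \<in> set (L)" for h
      using IH that gap by (fastforce simp: small_gap_def)
    moreover have "length (core (x # y # zs)) = Suc (length C)"
      "lifted (x # y # zs) = map ((+) 4) L"
      using False by (simp_all add: C_def L_def)
    ultimately show ?thesis using False IH by auto
  qed
qed

text \<open>Two parts around a multiple of 4 differ by at most 6. If their gap is too wide for the multiple to
  be removable, lowering the upper one by 4 turns the gap into a small one. The remaining shift by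
  \<open>4 * k\<close> comes from later extractions and affects both parts.\<close>

lemma wide_gap:
  assumes "\<not> small_gap x z" "z < x" "x \<le> z + 6" "4 * k < z"
  shows "small_gap (x - 4 * (1 + k)) (z - 4 * k) \<and> 4 * (1 + k) < x"
proof -
  obtain r where r: "z = 4 * k + r" "0 < r"
    using assms(4) less_imp_add_positive by blast
  obtain s where s: "x = z + s" "s \<le> 6" "0 < s"
    using less_imp_add_positive[OF assms(2)] assms(3) by auto
  have "s = 4 \<and> even z \<or> s = 5 \<or> s = 6"
    using assms(1) s by (auto simp: small_gap_def)
  then show ?thesis using r s by (auto simp: small_gap_def)
qed

text \<open>The facts about the core that hold for a suffix starting with a multiple of 4 as well, bundled so
  that the induction can step over such a multiple.\<close>

definition core_valid :: "nat list \<Rightarrow> bool" where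
  "core_valid xs \<longleftrightarrow> tight_chain (core xs) \<and> (\<forall>b\<in>set (core xs). \<not> 4 dvd b) \<and>
     map (\<lambda>b. b mod 4) (core xs) = map (\<lambda>b. b mod 4) (filter (\<lambda>b. \<not> 4 dvd b) xs) \<and>
     sum_list (core xs) + sum_list (lifted xs) = sum_list xs"

lemma core_valid_multiple: "4 dvd y \<Longrightarrow> core_valid xs \<Longrightarrow> core_valid (y # xs)"
  by (simp add: core_valid_def)

lemma core_valid_Cons:
  assumes x: "\<not> 4 dvd x" and lt: "4 * length (lifted xs) < x" and ok: "core_valid xs"
    and gap: "core xs = c # cs" "small_gap (x - 4 * length (lifted xs)) c"
  shows "core_valid (x # xs)"
proof -
  obtain r where r: "x = 4 * length (lifted xs) + r"
    using less_imp_add_positive[OF lt] by blast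
  have "\<not> 4 dvd r" "r mod 4 = x mod 4" using x by (auto simp: r)
  moreover have "sum_list (map ((+) 4) hs) = sum_list hs + 4 * length hs" for hs :: "nat list"
    by (induction hs) auto
  ultimately show ?thesis
    using x ok gap by (simp add: core_valid_def r)
qed

text \<open>The induction skips a multiple of 4 together with the part behind it: across the multiple it is
  the wide gap that becomes small, everywhere else both neighbours are lowered by the same amount.
  The inequality shows that the truncated subtraction in the core never truncates.\<close>

lemma core_spec:
  assumes "tight_chain (x # xs)" "reduced (x # xs)" "\<not> 4 dvd x"
  shows "4 * length (lifted xs) < x \<and> core_valid (x # xs)"
  using assms
proof (induction xs arbitrary: x rule: length_induct)
  case (1 xs)
  show ?case
  proof (cases xs)
    case Nil
    then show ?thesis using 1(2,4) by (simp add: core_valid_def)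
  next
    case (Cons y zs)
    have gap: "small_gap x y" and ch: "tight_chain (y # zs)" using 1(2) Cons by auto
    have red: "reduced (y # zs)" using reduced_ConsD[OF 1(3)] Cons by simp
    show ?thesis
    proof (cases "4 dvd y")
      case False
      have IH: "4 * length (lifted zs) < y" "core_valid (y # zs)"
        using 1(1)[rule_format, of zs y] Cons ch red False by auto
      have lt: "4 * length (lifted (y # zs)) < x"
        using False IH(1) gap by (simp add: small_gap_def)
      have "small_gap (x - 4 * length (lifted zs)) (y - 4 * length (lifted zs))"
        using gap IH(1) by (auto simp: small_gap_def)
      then show ?thesis
        using core_valid_Cons[OF 1(4) lt IH(2)] lt False Cons by simp
    next
      case True
      obtain z vs where z: "zs = z # vs" "\<not> 4 dvd z" "z < y" "y < z + 4"
        using multiple_not_adjacent[OF ch red True] by auto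
      have chz: "tight_chain (z # vs)" using ch z by simp
      have redz: "reduced (z # vs)" using reduced_ConsD[OF red] z by simp
      have IH: "4 * length (lifted vs) < z" "core_valid (z # vs)"
        using 1(1)[rule_format, of vs z] Cons chz redz z by auto
      have wide: "\<not> small_gap x z" using 1(3) Cons z True by simp
      have "y \<noteq> x" using 1(4) True by blast
      then have xy: "y < x" "x < y + 4" using gap True by (auto simp: small_gap_def)
      let ?k = "length (lifted vs)"
      have near: "small_gap (x - 4 * (1 + ?k)) (z - 4 * ?k)" and lt: "4 * (1 + ?k) < x"
        using wide_gap[OF wide _ _ IH(1)] xy z(3,4) by auto
      have len: "length (lifted xs) = 1 + ?k" using True z Cons by simp
      show ?thesis
        using core_valid_Cons[OF 1(4) _ core_valid_multiple[OF True IH(2)]] lt near len True z Cons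
        by simp
    qed
  qed
qed

lemma core_lifted_append:
  assumes "\<forall>p\<in>set ps. \<not> 4 dvd p"
  shows "core (ps @ zs) = map (\<lambda>p. p - 4 * length (lifted zs)) ps @ core zs"
    and "lifted (ps @ zs) = map ((+) (4 * length ps)) (lifted zs)"
  using assms by (induction ps) (auto simp: o_def map_idI)

lemma core_lifted_no_multiple:
  assumes "\<forall>p\<in>set ps. \<not> 4 dvd p"
  shows "core ps = ps" "lifted ps = []"
  using core_lifted_append[OF assms, of "[]"] by simp_all

lemma reduced_nonmultiple: "\<not> 4 dvd x \<Longrightarrow> reduced (w # x # xs) = reduced (x # xs)"
  by (cases xs) auto

text \<open>Lowering \<open>ps\<close> by 4 closes the gap that \<open>q\<close> leaves and changes no other gap. In particular the
  result is still decreasing, so the re-sorting after an extraction has no effect.\<close>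

lemma extraction_step:
  assumes "tight_chain (ps @ q # zs)" "reduced (ps @ q # zs)" "ps \<noteq> []" "4 dvd q"
    "\<forall>p\<in>set ps. \<not> 4 dvd p"
  shows "tight_chain (map (\<lambda>p. p - 4) ps @ zs) \<and> reduced (map (\<lambda>p. p - 4) ps @ zs) \<and>
    (\<forall>p\<in>set ps. 4 < p)"
  using assms
proof (induction ps)
  case (Cons w ps)
  have ch: "tight_chain (ps @ q # zs)" and red: "reduced (ps @ q # zs)"
    using Cons.prems(1,2) tight_chain_ConsD reduced_ConsD by fastforce+
  show ?case
  proof (cases ps)
    case Nil
    have qch: "tight_chain (q # zs)" and qred: "reduced (q # zs)" using ch red Nil by auto
    obtain y vs where y: "zs = y # vs" "\<not> 4 dvd y" "y < q" "q < y + 4"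
      using multiple_not_adjacent[OF qch qred Cons.prems(4)] by auto
    have "w \<noteq> q" using Cons.prems(4,5) by auto
    then have w: "q < w" "w < q + 4"
      using Cons.prems(1,4) Nil by (auto simp: small_gap_def)
    have wide: "\<not> small_gap w y" using Cons.prems(2,4) Nil y by simp
    have "0 < y" using tight_chain_positive[OF qch] y by simp
    then have "small_gap (w - 4) y \<and> 4 < w"
      using wide_gap[OF wide, of 0] w y by simp
    moreover have "tight_chain (y # vs)" using qch y by simp
    moreover have "reduced ((w - 4) # y # vs)"
      using y qred reduced_ConsD[of q "y # vs"] by (simp add: reduced_nonmultiple)
    ultimately show ?thesis using Nil y by simp
  next
    case (Cons w' ps')
    have IH: "tight_chain (map (\<lambda>p. p - 4) ps @ zs)" "reduced (map (\<lambda>p. p - 4) ps @ zs)"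
      "\<forall>p\<in>set ps. 4 < p"
      using Cons.IH[OF ch red] Cons Cons.prems by auto
    have w': "4 < w'" "\<not> 4 dvd w'" using IH(3) Cons Cons.prems(5) by auto
    have gap: "small_gap w w'" using Cons.prems(1) Cons by simp
    have "\<not> 4 dvd (w' - 4)" using w' by presburger
    moreover have "small_gap (w - 4) (w' - 4)" "4 < w" using gap w' by (auto simp: small_gap_def)
    ultimately show ?thesis using IH Cons by (simp add: reduced_nonmultiple)
  qed
qed simp

lemma iter_extract_eq:
  assumes "tight_chain xs" "reduced xs" "xs = [] \<or> \<not> 4 dvd hd xs"
  shows "iter_extract xs ds = (core xs, ds @ lifted xs)"
  using assms
proof (induction xs ds rule: iter_extract.induct)
  case (1 xs ds)
  show ?case
  proof (cases "find (\<lambda>j. 4 dvd xs ! j) [0..<length xs]")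
    case None
    then have "\<forall>x\<in>set xs. \<not> 4 dvd x" by (auto simp: find_None_iff in_set_conv_nth)
    then show ?thesis using None by (simp add: core_lifted_no_multiple iter_extract.simps[of xs])
  next
    case (Some j)
    then have j: "j < length xs" "4 dvd xs ! j" "\<forall>i<j. \<not> 4 dvd xs ! i"
      by (auto simp: find_Some_iff)
    define ps where "ps = take j xs"
    define q where "q = xs ! j"
    define zs where "zs = drop (Suc j) xs"
    have xs: "xs = ps @ q # zs"
      unfolding ps_def q_def zs_def using j(1) by (rule id_take_nth_drop)
    have ps: "\<forall>p\<in>set ps. \<not> 4 dvd p"
      using j(1,3) by (auto simp: ps_def in_set_conv_nth)
    have q: "4 dvd q" using j by (simp add: q_def)
    have "ps \<noteq> []" using 1(4) q by (auto simp: xs)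
    have step: "tight_chain (map (\<lambda>p. p - 4) ps @ zs)" "reduced (map (\<lambda>p. p - 4) ps @ zs)"
      "\<forall>p\<in>set ps. 4 < p"
      using extraction_step[OF _ _ \<open>ps \<noteq> []\<close> q ps, of zs] 1(2,3) by (auto simp: xs)
    have ps': "\<forall>p\<in>set (map (\<lambda>p. p - 4) ps). \<not> 4 dvd p"
    proof -
      have "\<not> 4 dvd (p - 4)" if "p \<in> set ps" for p
        using that ps step(3) by (metis dvd_minus_self not_less_iff_gr_or_eq)
      then show ?thesis by simp
    qed
    have srt: "reorder (map (\<lambda>p. p - 4) ps @ zs) = map (\<lambda>p. p - 4) ps @ zs"
      by (intro reorder_id sorted_desc_if_descends tight_chain_descends step(1))
    have "iter_extract xs ds =
        iter_extract (map (\<lambda>p. p - 4) ps @ zs) (ds @ [4 * j + q])"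
      using Some by (subst iter_extract.simps)
        (simp add: srt flip: ps_def q_def zs_def)
    also have "\<dots> = (core (map (\<lambda>p. p - 4) ps @ zs),
        (ds @ [4 * j + q]) @ lifted (map (\<lambda>p. p - 4) ps @ zs))"
      using 1(1)[OF Some] step ps' \<open>ps \<noteq> []\<close> srt
      by (simp add: hd_map flip: ps_def q_def zs_def)
    also have "\<dots> = (core xs, ds @ lifted xs)"
    proof -
      have "length ps = j" using j(1) by (simp add: ps_def)
      then show ?thesis
        unfolding xs core_lifted_append[OF ps] core_lifted_append[OF ps'] using q by simp
    qed
    finally show ?thesis .
  qed
qed

section \<open>Recovering a partition from its core and lifted parts\<close>

lemma core_nonempty: "tight_chain xs \<Longrightarrow> reduced xs \<Longrightarrow> xs \<noteq> [] \<Longrightarrow> core xs \<noteq> []"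
proof (cases xs)
  case (Cons x ys)
  assume *: "tight_chain xs" "reduced xs"
  show ?thesis
  proof (cases "4 dvd x")
    case True
    then obtain y zs where "ys = y # zs" "\<not> 4 dvd y"
      using multiple_not_adjacent * Cons by metis
    then show ?thesis using True Cons by simp
  qed (simp add: Cons)
qed auto

text \<open>Decoding step: with \<open>t\<close> lifted parts, a head \<open>x\<close> not divisible by 4 has become \<open>x - 4 * t\<close> in
  the core, and all lifted parts are at least \<open>x\<close>. If instead \<open>x\<close> is divisible by 4, it is itself
  the first lifted part, and it lies less than 4 above the next part, which has only \<open>t - 1\<close>
  multiples behind it. So core and lifted parts reveal which case holds.\<close>

lemma multiple_first_iff:
  assumes "tight_chain (x # xs)" "reduced (x # xs)"
  shows "4 dvd x \<longleftrightarrow> lifted (x # xs) \<noteq> [] \<and>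
    hd (lifted (x # xs)) < hd (core (x # xs)) + 4 * length (lifted (x # xs))"
proof (cases "4 dvd x")
  case True
  obtain y zs where y: "xs = y # zs" "\<not> 4 dvd y" "x < y + 4"
    by (rule multiple_not_adjacent[OF assms True])
  have "4 * length (lifted zs) < y"
    using core_spec[of y zs] tight_chain_ConsD[OF assms(1)] reduced_ConsD[OF assms(2)] y by simp
  then show ?thesis using True y by simp
next
  case False
  have lt: "4 * length (lifted xs) < x" using core_spec[OF assms False] by simp
  have "x \<le> hd (lifted (x # xs))" if "lifted (x # xs) \<noteq> []"
    using lifted_bounds[OF assms] hd_in_set[OF that] by blast
  then show ?thesis using False lt by auto
qed

lemma core_lifted_inject:
  assumes "tight_chain xs" "reduced xs" "tight_chain ys" "reduced ys"
    "core xs = core ys" "lifted xs = lifted ys"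
  shows "xs = ys"
  using assms
proof (induction xs arbitrary: ys)
  case Nil
  then show ?case using core_nonempty by fastforce
next
  case (Cons x xs)
  have "ys \<noteq> []" using Cons.prems core_nonempty[of "x # xs"] by auto
  then obtain y zs where ys: "ys = y # zs" by (cases ys) auto
  have iff: "4 dvd x \<longleftrightarrow> 4 dvd y"
    using multiple_first_iff Cons.prems unfolding ys by metis
  have tails: "tight_chain xs" "reduced xs" "tight_chain zs" "reduced zs"
    using Cons.prems tight_chain_ConsD reduced_ConsD unfolding ys by blast+
  show ?case
  proof (cases "4 dvd x")
    case True
    then show ?thesis using iff Cons.IH[OF tails] Cons.prems(5,6) ys by simp
  next
    case False
    have "map ((+) 4) (lifted xs) = map ((+) 4) (lifted zs)"
      using False iff Cons.prems(6) ys by simp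
    then have l: "lifted xs = lifted zs" by (simp add: inj_map_eq_map)
    have "4 * length (lifted xs) < x" "4 * length (lifted zs) < y"
      using core_spec[of x xs] core_spec[of y zs] Cons.prems(1-4) False iff ys by auto
    moreover have "x - 4 * length (lifted xs) = y - 4 * length (lifted zs)"
      using False iff Cons.prems(5) ys l by simp
    ultimately have "x = y" using l by (metis eq_diff_iff less_imp_le)
    moreover have "xs = zs" using False iff Cons.prems(5) ys l Cons.IH[OF tails] by simp
    ultimately show ?thesis using ys by simp
  qed
qed

lemma small_gap_residue_inject:
  assumes "small_gap x y" "small_gap u y" "x mod 4 = u mod 4"
  shows "x = u"
proof -
  have ineq: False if "small_gap a y" "small_gap b y" "a mod 4 = b mod 4" "a < b" for a b
  proof -
    have "4 dvd b - a" using that mod_eq_dvd_iff_nat[of a b 4] by simp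
    moreover have "y \<le> a" "b \<le> y + 4" using that by (auto simp: small_gap_def)
    ultimately have "a = y" "b = y + 4" using that(4) by (auto dest!: dvd_imp_le)
    then show False using that by (simp add: small_gap_def)
  qed
  show ?thesis using ineq assms by (metis linorder_neqE_nat)
qed

text \<open>A core is determined by its residues mod 4. Read from the last part, the residue fixes each gap
  except that 0 and 4 are congruent; but a gap of 0 forces even parts and a gap of 4 odd ones.
  Insertion adds multiples of 4 only, so the core can be recovered from the final partition.\<close>

lemma tight_chain_residue_inject:
  assumes "tight_chain bs" "tight_chain cs" "map (\<lambda>b. b mod 4) bs = map (\<lambda>b. b mod 4) cs"
    "\<forall>b\<in>set bs. \<not> 4 dvd b" "\<forall>b\<in>set cs. \<not> 4 dvd b"
  shows "bs = cs"
  using assms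
proof (induction bs arbitrary: cs rule: tight_chain.induct)
  case (2 x)
  then obtain y where "cs = [y]" by (cases cs) auto
  then show ?case using 2 by simp
next
  case (3 x y zs)
  obtain u v ws where cs: "cs = u # v # ws"
    using 3(4) by (metis length_map Suc_length_conv)
  have tl: "y # zs = v # ws" using 3(2-6) cs by (intro 3(1)) auto
  have "small_gap x y" "small_gap u y" "x mod 4 = u mod 4"
    using 3(2-4) tl by (simp_all add: cs)
  then have "x = u" by (rule small_gap_residue_inject)
  then show ?case using tl cs by simp
qed simp

section \<open>Insertion\<close>

lemma descends_raise_prefix:
  "sorted_wrt descends (as @ bs) \<Longrightarrow> sorted_wrt descends (map (\<lambda>x. x + 4) as @ bs)"
proof (induction as)
  case (Cons a as)
  have IH: "sorted_wrt descends (map (\<lambda>x. x + 4) as @ bs)" using Cons by simp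
  have "descends (a + 4) y" if y: "y \<in> set (map (\<lambda>x. x + 4) as @ bs)" for y
  proof (cases "y \<in> set bs")
    case True
    then have "y \<le> a" using Cons.prems by simp
    then show ?thesis by simp
  next
    case False
    then obtain z where "y = z + 4" "z \<in> set as" using y by auto
    then show ?thesis using Cons.prems by auto
  qed
  then show ?case using IH by simp
qed simp

text \<open>Raising an initial segment keeps the list decreasing, so the re-sorting has no effect.\<close>

lemma insert_part_eq:
  assumes "sorted_wrt descends xs"
  shows "insert_part d xs = map (\<lambda>x. x + 4) (take (d div 4) xs) @ drop (d div 4) xs"
    and "sorted_wrt descends (insert_part d xs)"
proof -
  let ?ys = "map (\<lambda>x. x + 4) (take (d div 4) xs) @ drop (d div 4) xs"
  have desc: "sorted_wrt descends ?ys"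
    using assms by (intro descends_raise_prefix) simp
  show eq: "insert_part d xs = ?ys"
    unfolding insert_part_def Let_def
    by (rule reorder_id[OF sorted_desc_if_descends[OF desc]])
  show "sorted_wrt descends (insert_part d xs)" unfolding eq by (rule desc)
qed

lemma fold_insert_part:
  assumes "sorted_wrt descends xs" "\<forall>d\<in>set ds. 4 dvd d \<and> d \<le> 4 * length xs"
  shows "length (fold insert_part ds xs) = length xs \<and>
    sorted_wrt descends (fold insert_part ds xs) \<and>
    map (\<lambda>x. x mod 4) (fold insert_part ds xs) = map (\<lambda>x. x mod 4) xs \<and>
    sum_list (fold insert_part ds xs) = sum_list xs + sum_list ds \<and>
    (\<forall>i<length xs. fold insert_part ds xs ! i = xs ! i + 4 * length (filter (\<lambda>d. i < d div 4) ds))"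
  using assms
proof (induction ds arbitrary: xs)
  case (Cons d ds)
  let ?xs = "insert_part d xs"
  note ins = insert_part_eq[OF Cons.prems(1), of d]
  have len: "length ?xs = length xs" by (simp add: ins(1))
  have md: "map (\<lambda>x. x mod 4) ?xs = map (\<lambda>x. x mod 4) xs"
  proof -
    have "map (\<lambda>x. x mod 4) ?xs =
        map (\<lambda>x. x mod 4) (take (d div 4) xs @ drop (d div 4) xs)"
      unfolding ins(1) map_append by simp
    then show ?thesis by simp
  qed
  have sm: "sum_list ?xs = sum_list xs + d"
  proof -
    have "d div 4 \<le> length xs" "4 * (d div 4) = d" using Cons.prems(2) by auto
    moreover have "sum_list (map (\<lambda>x. x + 4) ys) = sum_list ys + 4 * length ys" for ys :: "nat list"
      by (induction ys) auto
    ultimately have "sum_list ?xs = sum_list (take (d div 4) xs @ drop (d div 4) xs) + d"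
      unfolding ins(1) sum_list_append by simp
    then show ?thesis by simp
  qed
  have nth: "?xs ! i = xs ! i + (if i < d div 4 then 4 else 0)" if "i < length xs" for i
    using that by (simp add: ins(1) nth_append min_def)
  show ?case
    using Cons.IH[of ?xs] ins(2) Cons.prems(2) len md sm nth by simp
qed simp

text \<open>The multiplicity of \<open>4 * (i + 1)\<close> is the difference of two consecutive counts. These counts are
  what insertion adds to the individual parts, divided by 4.\<close>

lemma mset_eq_if_level_counts:
  fixes ds es :: "nat list" and k :: nat
  assumes "\<forall>d\<in>set ds \<union> set es. 4 dvd d \<and> 0 < d \<and> d \<le> 4 * k"
    "\<And>i. i < k \<Longrightarrow> length (filter (\<lambda>d. i < d div 4) ds) = length (filter (\<lambda>d. i < d div 4) es)"
  shows "mset ds = mset es"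
proof (rule multiset_eqI)
  fix x
  have level: "length (filter (\<lambda>d. i < d div 4) fs) =
      length (filter (\<lambda>d. Suc i < d div 4) fs) + count (mset fs) (4 * Suc i)"
    if "\<forall>d\<in>set fs. 4 dvd d" for fs :: "nat list" and i
    using that
  proof (induction fs)
    case (Cons d fs)
    then obtain m where "d = 4 * m" by auto
    have bools: "of_bool (i < d div 4) = of_bool (Suc i < d div 4) + (of_bool (d = 4 * Suc i) :: nat)"
      using \<open>d = 4 * m\<close> by (auto simp del: mult_Suc_right)
    have filter_Cons: "length (filter (\<lambda>d. j < d div 4) (d # fs)) =
        of_bool (j < d div 4) + length (filter (\<lambda>d. j < d div 4) fs)" for j
      by simp
    have count_Cons: "count (mset (d # fs)) (4 * Suc i) =
        of_bool (d = 4 * Suc i) + count (mset fs) (4 * Suc i)"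
      by (simp del: mult_Suc_right)
    have "length (filter (\<lambda>d. i < d div 4) fs) =
        length (filter (\<lambda>d. Suc i < d div 4) fs) + count (mset fs) (4 * Suc i)"
      using Cons.IH Cons.prems by simp
    then show ?case unfolding filter_Cons count_Cons bools by linarith
  qed simp
  \<comment> \<open>The level \<open>k\<close> itself is outside the hypothesis, but its count is 0 by the bound \<open>4 * k\<close>.\<close>
  have top: "filter (\<lambda>d. i < d div 4) fs = []" if "\<forall>d\<in>set fs. d \<le> 4 * k" "k \<le> i" for fs :: "nat list" and i
    using that by (fastforce simp: filter_empty_conv)
  have ds: "\<forall>d\<in>set ds. 4 dvd d" "\<forall>d\<in>set ds. d \<le> 4 * k"
    and es: "\<forall>d\<in>set es. 4 dvd d" "\<forall>d\<in>set es. d \<le> 4 * k" using assms(1) by auto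
  show "count (mset ds) x = count (mset es) x"
  proof (cases "4 dvd x \<and> 0 < x \<and> x \<le> 4 * k")
    case True
    then obtain m where m: "x = 4 * m" by blast
    with True obtain i where i: "x = 4 * Suc i" "i < k" by (cases m) auto
    have "length (filter (\<lambda>d. Suc i < d div 4) ds) = length (filter (\<lambda>d. Suc i < d div 4) es)"
      using assms(2)[of "Suc i"] top[OF ds(2), of "Suc i"] top[OF es(2), of "Suc i"]
      by (cases "Suc i < k") auto
    then show ?thesis
      using level[OF ds(1), of i] level[OF es(1), of i] assms(2)[OF i(2)] i(1) by simp
  next
    case False
    then have "x \<notin> set ds" "x \<notin> set es" using assms(1) by auto
    then have "count (mset ds) x = 0" "count (mset es) x = 0" by (simp_all add: count_eq_zero_iff del: count_mset)
    then show ?thesis by (rule trans[OF _ sym])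
  qed
qed

section \<open>Injectivity of the extraction-insertion algorithm\<close>

definition pre_extracted :: "nat list \<Rightarrow> bool" where
  "pre_extracted xs \<longleftrightarrow> tight_chain xs \<and> reduced xs \<and> (xs = [] \<or> \<not> 4 dvd hd xs)"

text \<open>The head of the list separates the two kinds of recorded parts: lifted parts exceed it, while
  pre-extracted ones, which satisfy the hypothesis of the last claim, are less than 4 above it. Both
  kinds are at most 4 times the number of core parts.\<close>

lemma pre_extracted_spec:
  assumes "pre_extracted xs"
  shows "core_valid xs" "sorted (lifted xs)"
    "\<forall>h\<in>set (lifted xs). 4 dvd h \<and> hd (xs @ [0]) < h \<and> h \<le> 4 * length (core xs)"
    "hd (xs @ [0]) = hd (core xs @ [0]) + 4 * length (lifted xs)"
    "\<And>e. 4 dvd e \<Longrightarrow> e < hd (xs @ [0]) + 4 \<Longrightarrow> e \<le> 4 * length (core xs)"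
proof -
  have "core_valid xs \<and> sorted (lifted xs) \<and>
    (\<forall>h\<in>set (lifted xs). 4 dvd h \<and> hd (xs @ [0]) < h \<and> h \<le> 4 * length (core xs)) \<and>
    hd (xs @ [0]) = hd (core xs @ [0]) + 4 * length (lifted xs) \<and>
    (\<forall>e. 4 dvd e \<longrightarrow> e < hd (xs @ [0]) + 4 \<longrightarrow> e \<le> 4 * length (core xs))"
  proof (cases xs)
    case Nil
    then show ?thesis by (auto simp: core_valid_def dest: dvd_imp_le)
  next
    case (Cons x ys)
    have *: "tight_chain (x # ys)" "reduced (x # ys)" "\<not> 4 dvd x"
      using assms Cons by (auto simp: pre_extracted_def)
    note bounds = lifted_bounds[OF *(1,2)]
    have "x < h" if "h \<in> set (lifted (x # ys))" for h
    proof -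
      have "x \<le> h" "4 dvd h" using bounds that by blast+
      then show ?thesis using *(3) by (cases "x = h") auto
    qed
    moreover have "e \<le> 4 * length (core (x # ys))" if "4 dvd e" "e < x + 4" for e
    proof -
      have "e < 4 * Suc (length (core (x # ys)))" using bounds that *(3) by simp
      then show ?thesis using \<open>4 dvd e\<close> by (auto simp del: mult_Suc_right)
    qed
    moreover have "core_valid (x # ys)" using core_spec[OF *] by simp
    moreover have "x = hd (core (x # ys) @ [0]) + 4 * length (lifted (x # ys))"
      using core_spec[OF *] *(3) by simp
    ultimately show ?thesis
      using bounds unfolding Cons append_Cons list.sel by blast
  qed
  then show "core_valid xs" "sorted (lifted xs)"
    "\<forall>h\<in>set (lifted xs). 4 dvd h \<and> hd (xs @ [0]) < h \<and> h \<le> 4 * length (core xs)"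
    "hd (xs @ [0]) = hd (core xs @ [0]) + 4 * length (lifted xs)"
    "\<And>e. 4 dvd e \<Longrightarrow> e < hd (xs @ [0]) + 4 \<Longrightarrow> e \<le> 4 * length (core xs)"
    by blast+
qed

lemma Phi_map_decomposition:
  assumes "tight_chain xs"
  obtains ys es where "pre_extracted ys" "mset xs = mset ys + mset es"
    "\<forall>e\<in>set es. 4 dvd e \<and> 0 < e \<and> e < hd (ys @ [0]) + 4"
    "Phi_map xs = fold insert_part (reorder (es @ lifted ys)) (core ys)"
proof -
  obtain ys es where pre: "pre_extract xs [] = (ys, es)" by fastforce
  note spec = pre_extract_spec[OF pre assms]
  have pre_extracted: "pre_extracted ys" using spec by (simp add: pre_extracted_def)
  have ms: "mset xs = mset ys + mset es" using spec by simp
  have "0 < e" if "e \<in> set es" for e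
  proof -
    have "e \<in># mset xs" unfolding ms using that by simp
    then show ?thesis using tight_chain_positive[OF assms] by simp
  qed
  then have es: "\<forall>e\<in>set es. 4 dvd e \<and> 0 < e \<and> e < hd (ys @ [0]) + 4" using spec by simp
  have "iter_extract ys es = (core ys, es @ lifted ys)"
    using pre_extracted unfolding pre_extracted_def by (intro iter_extract_eq) auto
  then have "Phi_map xs = fold insert_part (reorder (es @ lifted ys)) (core ys)"
    by (simp add: Phi_map_def pre)
  then show ?thesis using that pre_extracted ms es by blast
qed

lemma Phi_map_insertion:
  assumes "pre_extracted ys" "\<forall>e\<in>set es. 4 dvd e \<and> 0 < e \<and> e < hd (ys @ [0]) + 4"
  defines "zs \<equiv> fold insert_part (reorder (es @ lifted ys)) (core ys)"
  shows "\<forall>d\<in>set (es @ lifted ys). 4 dvd d \<and> 0 < d \<and> d \<le> 4 * length (core ys)"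
    and "length zs = length (core ys)" "sorted_wrt descends zs"
    and "map (\<lambda>x. x mod 4) zs = map (\<lambda>x. x mod 4) (core ys)"
    and "sum_list zs = sum_list (core ys) + sum_list (es @ lifted ys)"
    and "\<And>i. i < length (core ys) \<Longrightarrow>
           zs ! i = core ys ! i + 4 * length (filter (\<lambda>d. i < d div 4) (es @ lifted ys))"
proof -
  note norm = pre_extracted_spec[OF assms(1)]
  show bound: "\<forall>d\<in>set (es @ lifted ys). 4 dvd d \<and> 0 < d \<and> d \<le> 4 * length (core ys)"
    using assms(2) norm(3,5) by fastforce
  have desc: "sorted_wrt descends (core ys)"
    using norm(1) tight_chain_descends by (simp add: core_valid_def)
  let ?ds = "es @ lifted ys"
  have len: "length (filter P (reorder ?ds)) = length (filter P ?ds)" for P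
    by (metis mset_filter mset_reorder size_mset)
  have bound': "\<forall>d\<in>set (reorder ?ds). 4 dvd d \<and> d \<le> 4 * length (core ys)"
    using bound by simp
  show "length zs = length (core ys)" "sorted_wrt descends zs"
    "map (\<lambda>x. x mod 4) zs = map (\<lambda>x. x mod 4) (core ys)"
    "sum_list zs = sum_list (core ys) + sum_list (es @ lifted ys)"
    "\<And>i. i < length (core ys) \<Longrightarrow>
       zs ! i = core ys ! i + 4 * length (filter (\<lambda>d. i < d div 4) (es @ lifted ys))"
    using fold_insert_part[OF desc bound'] unfolding zs_def len sum_list_reorder by blast+
qed

lemma count_residue_map:
  "length (filter (\<lambda>x. x mod 4 = a) xs) = length (filter (\<lambda>r. r = a) (map (\<lambda>x. x mod 4) xs))"
  by (simp add: filter_map o_def)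

lemma Phi_map_spec:
  assumes "tight_chain xs"
  shows "sum_list (Phi_map xs) = sum_list xs"
    and "sorted_wrt descends (Phi_map xs)"
    and "\<forall>x\<in>set (Phi_map xs). \<not> 4 dvd x"
    and "0 < a \<Longrightarrow> length (filter (\<lambda>x. x mod 4 = a) (Phi_map xs)) =
           length (filter (\<lambda>x. x mod 4 = a) xs)"
proof -
  obtain ys es where dec: "pre_extracted ys" "mset xs = mset ys + mset es"
    "\<forall>e\<in>set es. 4 dvd e \<and> 0 < e \<and> e < hd (ys @ [0]) + 4"
    "Phi_map xs = fold insert_part (reorder (es @ lifted ys)) (core ys)"
    by (rule Phi_map_decomposition[OF assms])
  note ins = Phi_map_insertion[OF dec(1,3), folded dec(4)]
  have ok: "core_valid ys" by (rule pre_extracted_spec(1)[OF dec(1)])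
  have "sum_list xs = sum_list ys + sum_list es"
    using dec(2) by (metis sum_mset.union sum_mset_sum_list)
  then show "sum_list (Phi_map xs) = sum_list xs"
    using ins(5) ok by (simp add: core_valid_def)
  show "sorted_wrt descends (Phi_map xs)" by (rule ins(3))
  have "0 \<notin> set (map (\<lambda>x. x mod 4) (Phi_map xs))"
    unfolding ins(4) using ok by (auto simp: core_valid_def)
  then show "\<forall>x\<in>set (Phi_map xs). \<not> 4 dvd x" by force
  show "length (filter (\<lambda>x. x mod 4 = a) (Phi_map xs)) = length (filter (\<lambda>x. x mod 4 = a) xs)"
    if "0 < a"
  proof -
    have "map (\<lambda>x. x mod 4) (Phi_map xs) = map (\<lambda>x. x mod 4) (filter (\<lambda>b. \<not> 4 dvd b) ys)"
      using ins(4) ok by (simp add: core_valid_def)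
    then have "length (filter (\<lambda>x. x mod 4 = a) (Phi_map xs)) =
        length (filter (\<lambda>x. x mod 4 = a) (filter (\<lambda>b. \<not> 4 dvd b) ys))"
      unfolding count_residue_map by simp
    also have "\<dots> = length (filter (\<lambda>x. x mod 4 = a) ys)"
      using that by (auto simp: dvd_eq_mod_eq_0 intro!: arg_cong[of _ _ length] filter_cong)
    also have "\<dots> = length (filter (\<lambda>x. x mod 4 = a) xs)"
    proof -
      have "filter (\<lambda>x. x mod 4 = a) es = []"
        using dec(3) that by (auto simp: filter_empty_conv)
      then have "filter_mset (\<lambda>x. x mod 4 = a) (mset es) = {#}"
        by (metis mset_filter mset.simps(1))
      then have "filter_mset (\<lambda>x. x mod 4 = a) (mset xs) = filter_mset (\<lambda>x. x mod 4 = a) (mset ys)"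
        unfolding dec(2) by simp
      then show ?thesis by (metis mset_filter size_mset)
    qed
    finally show ?thesis .
  qed
qed

text \<open>The number of lifted parts is determined by the multiset of all recorded parts and the largest
  core part \<open>m\<close>, as the side of a Durfee square is: with \<open>t\<close> lifted parts, these exceed
  \<open>m + 4 * t\<close>, while the others are less than \<open>m + 4 * (t + 1)\<close>.\<close>

lemma recorded_parts_length_le:
  fixes es hs es' hs' :: "nat list"
  assumes "\<forall>e\<in>set es. e < m + 4 * length hs + 4"
    "\<forall>h\<in>set hs'. m + 4 * length hs' < h" "mset (es @ hs) = mset (es' @ hs')"
  shows "length hs' \<le> length hs"
proof (rule ccontr)
  assume less: "\<not> length hs' \<le> length hs"
  \<comment> \<open>This threshold lies below all of \<open>hs'\<close> and, by assumption, above all of \<open>es\<close>.\<close>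
  let ?f = "filter (\<lambda>d. m + 4 * length hs' < d)"
  have "?f es = []" using assms(1) less by (fastforce simp: filter_empty_conv)
  then have "length (?f (es @ hs)) \<le> length hs" by simp
  moreover have "?f hs' = hs'" using assms(2) by (simp add: filter_id_conv)
  then have "length hs' \<le> length (?f (es' @ hs'))" by simp
  moreover have "length (?f (es @ hs)) = length (?f (es' @ hs'))"
    using assms(3) by (metis mset_filter size_mset)
  ultimately show False using less by simp
qed

text \<open>Both kinds of parts are multiples of 4, so a pre-extracted part may equal a lifted one but cannot
  exceed it. Sorted increasingly, the lifted parts therefore come last, and their number is
  determined by the previous lemma.\<close>

lemma recorded_parts_split:
  fixes es hs es' hs' :: "nat list"
  assumes "\<forall>e\<in>set es. 4 dvd e \<and> e < m + 4 * length hs + 4"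
    "\<forall>h\<in>set hs. 4 dvd h \<and> m + 4 * length hs < h" "sorted hs"
    "\<forall>e\<in>set es'. 4 dvd e \<and> e < m + 4 * length hs' + 4"
    "\<forall>h\<in>set hs'. 4 dvd h \<and> m + 4 * length hs' < h" "sorted hs'"
    "mset (es @ hs) = mset (es' @ hs')"
  shows "hs = hs' \<and> mset es = mset es'"
proof -
  have le: "sorted (sort as @ bs)"
    if "\<forall>e\<in>set as. 4 dvd e \<and> e < k + 4" "\<forall>h\<in>set bs. 4 dvd h \<and> k < h" "sorted bs"
    for as bs :: "nat list" and k
  proof -
    have "e \<le> h" if "4 dvd e" "e < k + 4" "4 dvd h" "k < h" for e h
      using that by presburger
    then show ?thesis using that by (auto simp: sorted_append)
  qed
  have "sorted (sort es @ hs)" "sorted (sort es' @ hs')"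
    using le[of es "m + 4 * length hs" hs] le[of es' "m + 4 * length hs'" hs'] assms by auto
  moreover have "mset (sort es @ hs) = mset (sort es' @ hs')" using assms(7) by simp
  ultimately have eq: "sort es @ hs = sort es' @ hs'"
    by (metis properties_for_sort)
  have "length hs' \<le> length hs"
    by (rule recorded_parts_length_le[of es m hs hs' es']) (use assms in auto)
  moreover have "length hs \<le> length hs'"
    by (rule recorded_parts_length_le[of es' m hs' hs es]) (use assms in auto)
  ultimately have "hs = hs'" "sort es = sort es'" using eq by (simp_all add: append_eq_append_conv)
  then show ?thesis by (metis mset_sort)
qed

text \<open>Decoding runs backwards: residues give the core, the differences to the core give the recorded
  parts, their size separates pre-extracted from lifted ones, and core and lifted parts give the
  partition before iterative extraction.\<close>

lemma Phi_map_inject: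
  assumes "tight_chain xs" "tight_chain xs'" "Phi_map xs = Phi_map xs'"
  shows "xs = xs'"
proof -
  obtain ys es where dec: "pre_extracted ys" "mset xs = mset ys + mset es"
    "\<forall>e\<in>set es. 4 dvd e \<and> 0 < e \<and> e < hd (ys @ [0]) + 4"
    "Phi_map xs = fold insert_part (reorder (es @ lifted ys)) (core ys)"
    by (rule Phi_map_decomposition[OF assms(1)])
  obtain ys' es' where dec': "pre_extracted ys'" "mset xs' = mset ys' + mset es'"
    "\<forall>e\<in>set es'. 4 dvd e \<and> 0 < e \<and> e < hd (ys' @ [0]) + 4"
    "Phi_map xs' = fold insert_part (reorder (es' @ lifted ys')) (core ys')"
    by (rule Phi_map_decomposition[OF assms(2)])
  note ins = Phi_map_insertion[OF dec(1,3), folded dec(4)]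
  note ins' = Phi_map_insertion[OF dec'(1,3), folded dec'(4), folded assms(3)]
  note norm = pre_extracted_spec[OF dec(1)] and norm' = pre_extracted_spec[OF dec'(1)]
  have core: "core ys = core ys'"
    using tight_chain_residue_inject[of "core ys" "core ys'"] norm(1) norm'(1) ins(4) ins'(4)
    by (simp add: core_valid_def)
  have "mset (es @ lifted ys) = mset (es' @ lifted ys')"
  proof (rule mset_eq_if_level_counts)
    show "\<forall>d\<in>set (es @ lifted ys) \<union> set (es' @ lifted ys'). 4 dvd d \<and> 0 < d \<and> d \<le> 4 * length (core ys)"
      using ins(1) ins'(1) core by auto
    show "length (filter (\<lambda>d. i < d div 4) (es @ lifted ys)) =
        length (filter (\<lambda>d. i < d div 4) (es' @ lifted ys'))" if "i < length (core ys)" for i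
      using ins(6)[OF that] ins'(6)[of i] that core by simp
  qed
  then have eq: "lifted ys = lifted ys' \<and> mset es = mset es'"
    using recorded_parts_split[of es "hd (core ys @ [0])" "lifted ys" es' "lifted ys'"]
      dec(3) dec'(3) norm(2-4) norm'(2-4) core by simp
  then have "ys = ys'"
    using core_lifted_inject dec(1) dec'(1) core by (simp add: pre_extracted_def)
  then have "mset xs = mset xs'" using dec(2) dec'(2) eq by simp
  then show ?thesis
    using assms(1,2) by (intro sorted_desc_eqI sorted_desc_if_descends tight_chain_descends)
qed

section \<open>Column sums of the 2-modular diagram\<close>

text \<open>The entry of a row \<open>x\<close> in column \<open>c\<close>, extended by 0 beyond the end of the row.\<close>

definition entry :: "nat \<Rightarrow> nat \<Rightarrow> nat" where
  "entry x c = (if 2 * c + 2 \<le> x then 2 else if x = 2 * c + 1 then 1 else 0)"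

definition column :: "nat list \<Rightarrow> nat \<Rightarrow> nat" where
  "column xs c = (\<Sum>x\<leftarrow>xs. entry x c)"

lemma column_simps [simp]:
  "column [] c = 0" "column (x # xs) c = entry x c + column xs c"
  "column (xs @ ys) c = column xs c + column ys c"
  by (simp_all add: column_def)

lemma entry_row:
  "(if c < length (two_modular_row x) then two_modular_row x ! c else 0) = entry x c"
proof -
  have x: "x = 2 * (x div 2) + x mod 2" by simp
  consider "x mod 2 = 0" | "x mod 2 = 1" by linarith
  then show ?thesis
    by cases (use x in \<open>auto simp: two_modular_row_def entry_def nth_append\<close>)
qed

lemma column_pos_iff: "0 < column xs c \<longleftrightarrow> (\<exists>x\<in>set xs. 2 * c + 1 \<le> x)"
  by (induction xs) (auto simp: entry_def)

lemma less_length_transpose_iff: "c < length (transpose rows) \<longleftrightarrow> (\<exists>r\<in>set rows. c < length r)"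
  unfolding length_transpose by (induction rows) (auto simp: less_max_iff_disj)

lemma phi_map_eq_columns:
  obtains L where "phi_map xs = map (column xs) [0..<L]" "\<And>c. c < L \<longleftrightarrow> 0 < column xs c"
proof
  let ?rows = "map two_modular_row xs"
  let ?L = "length (transpose ?rows)"
  have "sum_list (transpose ?rows ! c) = column xs c" if "c < ?L" for c
  proof -
    have "sum_list (transpose ?rows ! c) =
        sum_list (map (\<lambda>r. r ! c) (filter (\<lambda>r. c < length r) ?rows))"
      using that by (simp add: nth_transpose)
    also have "\<dots> = sum_list (map (\<lambda>r. if c < length r then r ! c else 0) ?rows)"
      by (simp add: sum_list_map_filter')
    also have "\<dots> = column xs c"
      by (simp add: column_def o_def entry_row)
    finally show ?thesis .
  qed
  then show "phi_map xs = map (column xs) [0..<?L]"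
    by (intro nth_equalityI) (simp_all add: phi_map_def)
  have len: "c < length (two_modular_row x) \<longleftrightarrow> 2 * c + 1 \<le> x" for x c
    by (simp add: two_modular_row_def) presburger
  show "c < ?L \<longleftrightarrow> 0 < column xs c" for c
    by (simp add: less_length_transpose_iff column_pos_iff len)
qed

lemma column_eq_phi_map: "column xs c = (if c < length (phi_map xs) then phi_map xs ! c else 0)"
proof -
  obtain L where "phi_map xs = map (column xs) [0..<L]" "\<And>c. c < L \<longleftrightarrow> 0 < column xs c"
    by (rule phi_map_eq_columns[of xs]) blast
  then show ?thesis by auto
qed

text \<open>Neighbouring columns differ only in the rows that end in one of them. For a strict partition all
  multiplicities are at most 1, so the gap is at most 4, and it equals 4 only if \<open>2 * c + 1\<close> and
  \<open>2 * c + 3\<close> are both parts, in which case both column sums are odd. The same recurrence recovers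
  the partition from its column sums.\<close>

lemma column_Suc:
  "column xs c = column xs (Suc c) + count_list xs (2 * c + 1)
     + 2 * count_list xs (2 * c + 2) + count_list xs (2 * c + 3)"
proof (induction xs)
  case (Cons x xs)
  have "entry x c = entry x (Suc c) + of_bool (x = 2 * c + 1)
     + 2 * of_bool (x = 2 * c + 2) + of_bool (x = 2 * c + 3)"
    by (auto simp: entry_def)
  then show ?case using Cons by simp
qed simp

lemma odd_column_iff: "odd (column xs c) \<longleftrightarrow> odd (count_list xs (2 * c + 1))"
  by (induction xs) (auto simp: entry_def)

lemma tight_chain_mapI:
  assumes "\<And>c. small_gap (f c) (f (Suc c))" "\<And>c. c < L \<longleftrightarrow> 0 < f c"
  shows "tight_chain (map f [c..<L])"
proof (induction "L - c" arbitrary: c)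
  case (Suc k)
  have up: "[c..<L] = c # [Suc c..<L]" using Suc(2) by (simp add: upt_conv_Cons)
  have IH: "tight_chain (map f [Suc c..<L])" using Suc by simp
  show ?case
  proof (cases "Suc c < L")
    case True
    then have "[Suc c..<L] = Suc c # [Suc (Suc c)..<L]" by (simp add: upt_conv_Cons)
    then show ?thesis using up IH assms(1)[of c] by simp
  next
    case False
    then have "f (Suc c) = 0" using assms(2)[of "Suc c"] by simp
    then have "f c < 4" using assms(1)[of c] by (simp add: small_gap_def)
    moreover have "c < L" using Suc(2) by linarith
    then have "0 < f c" using assms(2)[of c] by simp
    ultimately show ?thesis using up False by simp
  qed
qed simp

lemma count_list_distinct: "distinct xs \<Longrightarrow> count_list xs x = of_bool (x \<in> set xs)"
  by (induction xs) auto

lemma small_gap_columns: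
  assumes "distinct xs"
  shows "small_gap (column xs c) (column xs (Suc c))"
proof -
  have "odd (column xs c) \<longleftrightarrow> 2 * c + 1 \<in> set xs" for c
    by (simp add: odd_column_iff count_list_distinct[OF assms])
  from this[of c] this[of "Suc c"] show ?thesis
    using column_Suc[of xs c] unfolding small_gap_def count_list_distinct[OF assms]
    by (auto simp: numeral_3_eq_3)
qed

lemma tight_chain_phi_map: "distinct xs \<Longrightarrow> tight_chain (phi_map xs)"
  by (rule phi_map_eq_columns[of xs]) (simp add: tight_chain_mapI small_gap_columns)

lemma sum_list_phi_map: "sum_list (phi_map xs) = sum_list xs"
proof -
  obtain L where L: "phi_map xs = map (column xs) [0..<L]" "\<And>c. c < L \<longleftrightarrow> 0 < column xs c"
    by (rule phi_map_eq_columns[of xs]) blast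
  have bound: "\<forall>x\<in>set xs. x \<le> 2 * L" using L(2)[of L] column_pos_iff[of xs L] by force
  have row: "(\<Sum>c\<leftarrow>[0..<N]. entry x c) = min x (2 * N)" for x N
    by (induction N) (auto simp: entry_def)
  have "sum_list (map (column xs) [0..<L]) = sum_list xs"
    using bound
  proof (induction xs)
    case (Cons x xs)
    then show ?case by (simp add: sum_list_addf row)
  qed simp
  then show ?thesis using L(1) by simp
qed

lemma strict_phi_map_inject:
  assumes "distinct xs" "distinct ys" "sorted_wrt (\<ge>) xs" "sorted_wrt (\<ge>) ys"
    "0 \<notin> set xs" "0 \<notin> set ys" "phi_map xs = phi_map ys"
  shows "xs = ys"
proof -
  have col: "column xs c = column ys c" for c
    using assms(7) by (simp add: column_eq_phi_map)
  have odd: "count_list xs (2 * c + 1) = count_list ys (2 * c + 1)" for c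
    using odd_column_iff[of xs c] odd_column_iff[of ys c] col
    by (simp add: count_list_distinct assms(1,2))
  have even: "count_list xs (2 * c + 2) = count_list ys (2 * c + 2)" for c
    using column_Suc[of xs c] column_Suc[of ys c] col[of c] col[of "Suc c"] odd[of c] odd[of "Suc c"]
    by (simp add: numeral_3_eq_3)
  have "count_list xs x = count_list ys x" for x
  proof -
    consider "x = 0" | c where "x = 2 * c + 1" | c where "x = 2 * c + 2"
    proof (cases x)
      case (Suc y)
      then show ?thesis using that by (cases "even y") (auto elim!: evenE oddE)
    qed (use that in blast)
    then show ?thesis
      using odd even assms(5,6) by cases (auto simp: count_list_0_iff)
  qed
  then have "mset xs = mset ys" by (intro multiset_eqI) (simp add: count_mset)
  then show ?thesis by (rule sorted_desc_eqI[OF assms(3,4)])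
qed

text \<open>The entry 1 of the odd part at position \<open>i\<close> has only entries 2 above it, one for each of the \<open>i\<close>
  larger parts.\<close>

lemma column_at_odd_part:
  assumes "distinct xs" "sorted_wrt (\<ge>) xs" "i < length xs" "odd (xs ! i)"
  shows "column xs (xs ! i div 2) = 2 * i + 1"
proof -
  let ?c = "xs ! i div 2"
  have x: "xs ! i = 2 * ?c + 1" using assms(4) by simp
  have split: "xs = take i xs @ xs ! i # drop (Suc i) xs" by (rule id_take_nth_drop[OF assms(3)])
  have strict: "sorted_wrt (>) xs"
    using assms(1,2) by (auto simp: sorted_wrt_iff_nth_less nth_eq_iff_index_eq le_less)
  have "column (take i xs @ xs ! i # drop (Suc i) xs) ?c = 2 * i + 1"
  proof -
    have "column ys ?c = 2 * length ys" if "\<forall>y\<in>set ys. xs ! i < y" for ys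
      using that x by (induction ys) (auto simp: entry_def)
    moreover have "column ys ?c = 0" if "\<forall>y\<in>set ys. y < xs ! i" for ys
      using that x by (induction ys) (auto simp: entry_def)
    moreover have "sorted_wrt (>) (take i xs @ xs ! i # drop (Suc i) xs)"
      using strict by (simp flip: split)
    then have "\<forall>y\<in>set (take i xs). xs ! i < y" "\<forall>y\<in>set (drop (Suc i) xs). y < xs ! i"
      by (auto simp: sorted_wrt_append)
    moreover have "entry (xs ! i) ?c = 1" by (subst x) (simp add: entry_def)
    ultimately show ?thesis using assms(3) by simp
  qed
  then show ?thesis by (simp only: split[symmetric])
qed

text \<open>By the previous lemma the \<open>r\<close>-th part, if odd, gives a column with sum \<open>2 * r - 1\<close>, which is 1 or 3
  mod 4 according to the parity of \<open>r\<close>; all odd column sums arise in this way.\<close>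

lemma residue_count_phi_map:
  assumes "distinct xs" "sorted_wrt (\<ge>) xs" "a = 1 \<or> a = 3"
  shows "residue_count a (phi_map xs) =
    card {r. 1 \<le> r \<and> r \<le> length xs \<and> odd (xs ! (r - 1)) \<and> (odd r \<longleftrightarrow> a = 1)}"
proof -
  let ?R = "{r. 1 \<le> r \<and> r \<le> length xs \<and> odd (xs ! (r - 1)) \<and> (odd r \<longleftrightarrow> a = 1)}"
  let ?g = "\<lambda>r. xs ! (r - 1) div 2"
  have mod: "(2 * i + 1) mod 4 = a mod 4 \<longleftrightarrow> (odd (Suc i) \<longleftrightarrow> a = 1)" for i :: nat
  proof -
    consider k where "i = 2 * k" | k where "i = 2 * k + 1" by (cases "even i") (auto elim!: evenE oddE)
    then show ?thesis using assms(3) by cases (auto simp: mod_add_eq[symmetric])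
  qed
  have "{s. s < length (phi_map xs) \<and> phi_map xs ! s mod 4 = a mod 4} =
      {s. column xs s mod 4 = a mod 4}"
    using assms(3) by (auto simp: column_eq_phi_map)
  also have "\<dots> = ?g ` ?R"
  proof (intro equalityI subsetI)
    fix s assume s: "s \<in> {s. column xs s mod 4 = a mod 4}"
    then have s4: "column xs s mod 4 = a mod 4" by simp
    then have "odd (column xs s)" using assms(3) by presburger
    then have "2 * s + 1 \<in> set xs"
      by (simp add: odd_column_iff count_list_distinct[OF assms(1)])
    then obtain i where i: "i < length xs" "xs ! i = 2 * s + 1" by (auto simp: in_set_conv_nth)
    then have "column xs s = 2 * i + 1"
      using column_at_odd_part[OF assms(1,2) i(1)] by simp
    then have "odd (Suc i) \<longleftrightarrow> a = 1" using s4 mod[of i] by simp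
    then have "Suc i \<in> ?R" "?g (Suc i) = s" using i by auto
    then show "s \<in> ?g ` ?R" by blast
  next
    fix s assume "s \<in> ?g ` ?R"
    then obtain r where r: "r \<in> ?R" "s = ?g r" by blast
    then obtain i where "r = Suc i" by (cases r) auto
    with r have "i < length xs" "odd (xs ! i)" "odd (Suc i) \<longleftrightarrow> a = 1" "s = xs ! i div 2"
      by auto
    then show "s \<in> {s. column xs s mod 4 = a mod 4}"
      using column_at_odd_part[OF assms(1,2)] mod by simp
  qed
  finally have "residue_count a (phi_map xs) = card (?g ` ?R)" by (simp add: residue_count_def)
  also have "\<dots> = card ?R"
  proof (rule card_image, rule inj_onI)
    fix r s assume rs: "r \<in> ?R" "s \<in> ?R" "?g r = ?g s"
    then have "xs ! (r - 1) = xs ! (s - 1)" by (auto elim!: oddE)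
    moreover have "0 < r" "0 < s" "r - 1 < length xs" "s - 1 < length xs" using rs by auto
    ultimately have "r - 1 = s - 1" using nth_eq_iff_index_eq[OF assms(1)] by blast
    then show "r = s" using \<open>0 < r\<close> \<open>0 < s\<close> by linarith
  qed
  finally show ?thesis .
qed

lemma residue_count_conv_filter: "a < 4 \<Longrightarrow> residue_count a xs = length (filter (\<lambda>x. x mod 4 = a) xs)"
  by (simp add: residue_count_def length_filter_conv_card)

section \<open>Binary digits and Glaisher's map\<close>

lemma part_le_sum_list: "(x :: nat) \<in> set xs \<Longrightarrow> x \<le> sum_list xs"
  by (rule member_le_sum_list) simp_all

lemma count_list_replicate: "count_list (replicate n x) y = (if x = y then n else 0)"
  by (induction n) auto

lemma count_list_psi_inv:
  "count_list (psi_inv xs) m = (if odd m then count_list xs m + 2 * count_list xs (2 * m) else 0)"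
proof -
  have blocks: "count_list (concat (map (\<lambda>m. replicate (g m) m) ms)) x = (if x \<in> set ms then g x else 0)"
    if "distinct ms" for g :: "nat \<Rightarrow> nat" and ms x
    using that by (induction ms) (auto simp: count_list_replicate)
  have "count_list xs x = 0" if "sum_list xs < x" for x
    using that part_le_sum_list[of x xs] by (auto simp: count_list_0_iff)
  then show ?thesis unfolding psi_inv_def by (subst blocks) (auto simp del: upt_Suc)
qed

lemma sum_list_psi_inv:
  assumes "\<forall>x\<in>set xs. \<not> 4 dvd x"
  shows "sum_list (psi_inv xs) = sum_list xs"
proof -
  define M where "M N = {m. odd m \<and> m \<le> N}" for N :: nat
  have fin: "finite (M N)" for N by (simp add: M_def)
  have sum: "(\<Sum>m\<in>M N. (count_list xs m + 2 * count_list xs (2 * m)) * m) = sum_list xs"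
    if "\<forall>x\<in>set xs. \<not> 4 dvd x \<and> x \<le> N" for xs N
    using that
  proof (induction xs)
    case (Cons x xs)
    have "(\<Sum>m\<in>M N. (of_bool (x = m) + 2 * of_bool (x = 2 * m)) * m) = x"
    proof (cases "odd x")
      case True
      then have "(of_bool (x = m) + 2 * of_bool (x = 2 * m)) * m = (if m = x then x else 0)" for m
        by auto
      then show ?thesis using fin True Cons.prems by (simp add: M_def)
    next
      case False
      then obtain k where k: "x = 2 * k" by blast
      then have "odd k" using Cons.prems by auto
      have "(\<Sum>m\<in>M N. (of_bool (x = m) + 2 * of_bool (x = 2 * m)) * m) =
          (\<Sum>m\<in>M N. if m = k then x else 0)"
        by (rule sum.cong) (auto simp: k M_def)
      then show ?thesis using fin \<open>odd k\<close> k Cons.prems by (simp add: M_def)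
    qed
    moreover have "(\<Sum>m\<in>M N. (count_list (x # xs) m + 2 * count_list (x # xs) (2 * m)) * m) =
        (\<Sum>m\<in>M N. (of_bool (x = m) + 2 * of_bool (x = 2 * m)) * m) +
        (\<Sum>m\<in>M N. (count_list xs m + 2 * count_list xs (2 * m)) * m)"
      unfolding sum.distrib[symmetric] by (rule sum.cong) (auto simp: algebra_simps)
    ultimately show ?case using Cons by simp
  qed simp
  have "set (psi_inv xs) \<subseteq> M (sum_list xs)"
    by (auto simp: psi_inv_def M_def less_Suc_eq_le simp del: upt_Suc)
  then have "sum_list (psi_inv xs) = (\<Sum>m\<in>M (sum_list xs). count_list (psi_inv xs) m * m)"
    using sum_list_map_eq_sum_count2[of "psi_inv xs" "M (sum_list xs)" id] fin by simp
  also have "\<dots> = (\<Sum>m\<in>M (sum_list xs). (count_list xs m + 2 * count_list xs (2 * m)) * m)"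
    by (rule sum.cong) (simp_all add: count_list_psi_inv M_def)
  also have "\<dots> = sum_list xs"
    using assms part_le_sum_list by (intro sum) auto
  finally show ?thesis .
qed

definition glaisher_block :: "nat list \<Rightarrow> nat \<Rightarrow> nat list" where
  "glaisher_block xs m = (if odd m
     then map (\<lambda>c. 2 ^ c * m) (filter (bit (count_list xs m)) [0..<count_list xs m]) else [])"

lemma glaisher_eq_blocks:
  "glaisher xs = reorder (concat (map (glaisher_block xs) [0..<Suc (sum_list xs)]))"
proof -
  have "concat (map (\<lambda>c. if P c then [f c] else []) cs) = map f (filter P cs)"
    for P and f :: "nat \<Rightarrow> nat" and cs
    by (induction cs) auto
  then show ?thesis unfolding glaisher_def glaisher_block_def
    by (simp del: upt_Suc cong: if_cong)
qed

lemma bit_nat_less: "bit k c \<Longrightarrow> c < (k :: nat)"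
proof -
  assume "bit k c"
  then have "2 ^ c \<le> k" by (metis bit_iff_odd div_less even_zero not_le)
  then show ?thesis using less_exp[of c] by linarith
qed

text \<open>The smaller power of 2 cancels and leaves an odd number on its side.\<close>

lemma odd_part_unique:
  fixes m m' :: nat
  assumes "2 ^ c * m = 2 ^ c' * m'" "odd m" "odd m'"
  shows "c = c' \<and> m = m'"
proof -
  have le: "c \<le> c'" if "2 ^ c * m = 2 ^ c' * m'" "odd m'" for c c' m m' :: nat
  proof (rule ccontr)
    assume "\<not> c \<le> c'"
    then obtain k where "c = c' + Suc k" by (metis less_iff_Suc_add not_le add_Suc_right)
    then show False using that by (auto simp: power_add)
  qed
  have "c = c'" using le[OF assms(1,3)] le[OF assms(1)[symmetric] assms(2)] by simp
  then show ?thesis using assms(1) by simp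
qed

lemma set_glaisher:
  "x \<in> set (glaisher xs) \<longleftrightarrow> (\<exists>m c. odd m \<and> x = 2 ^ c * m \<and> bit (count_list xs m) c)"
proof
  assume "\<exists>m c. odd m \<and> x = 2 ^ c * m \<and> bit (count_list xs m) c"
  then obtain m c where mc: "odd m" "x = 2 ^ c * m" "bit (count_list xs m) c" by blast
  then have "m \<in> set xs" by (metis bit_nat_less count_list_0_iff not_less_zero)
  then have "m < Suc (sum_list xs)" using part_le_sum_list by (simp add: less_Suc_eq_le)
  moreover have "x \<in> set (glaisher_block xs m)"
    using mc bit_nat_less[OF mc(3)] by (auto simp: glaisher_block_def)
  ultimately show "x \<in> set (glaisher xs)" unfolding glaisher_eq_blocks by (auto simp del: upt_Suc)
qed (auto simp: glaisher_eq_blocks glaisher_block_def split: if_splits)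

lemma power_mult_mem_glaisher_iff:
  "odd m \<Longrightarrow> 2 ^ c * m \<in> set (glaisher xs) \<longleftrightarrow> bit (count_list xs m) c"
  unfolding set_glaisher using odd_part_unique by blast

lemma distinct_glaisher: "distinct (glaisher xs)"
proof -
  have concat: "distinct (concat (map f ms))"
    if "distinct ms" "\<And>m. distinct (f m)" "\<And>m m' x. x \<in> set (f m) \<Longrightarrow> x \<in> set (f m') \<Longrightarrow> m = m'"
    for f :: "nat \<Rightarrow> nat list" and ms
    using that(1) by (induction ms) (use that(2,3) in auto)
  have "distinct (glaisher_block xs m)" for m
    by (auto simp: glaisher_block_def distinct_map inj_on_def)
  moreover have "m = m'" if x: "x \<in> set (glaisher_block xs m)" "x \<in> set (glaisher_block xs m')" for m m' x
  proof -
    obtain c where "x = 2 ^ c * m" "odd m"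
      using x(1) by (auto simp: glaisher_block_def split: if_splits)
    moreover obtain c' where "x = 2 ^ c' * m'" "odd m'"
      using x(2) by (auto simp: glaisher_block_def split: if_splits)
    ultimately show ?thesis using odd_part_unique[of c m c' m'] by simp
  qed
  ultimately have "distinct (concat (map (glaisher_block xs) [0..<Suc (sum_list xs)]))"
    by (intro concat) auto
  then show ?thesis unfolding glaisher_eq_blocks
    by (simp only: reorder_def distinct_rev distinct_sort)
qed

lemma sum_list_glaisher:
  assumes "\<forall>x\<in>set xs. odd x"
  shows "sum_list (glaisher xs) = sum_list xs"
proof -
  have binary: "(\<Sum>c\<leftarrow>filter (bit k) [0..<k]. 2 ^ c) = (k :: nat)" for k
  proof -
    have "(\<Sum>c\<leftarrow>filter (bit k) [0..<k]. 2 ^ c) = (\<Sum>c\<leftarrow>[0..<k]. push_bit c (of_bool (bit k c)))"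
      by (simp add: sum_list_map_filter' push_bit_eq_mult of_bool_def if_distrib cong: if_cong)
    also have "\<dots> = take_bit k k"
      by (simp add: take_bit_sum interv_sum_list_conv_sum_set_nat)
    also have "\<dots> = k" by (simp add: take_bit_nat_eq_self)
    finally show ?thesis .
  qed
  have block: "sum_list (glaisher_block xs m) = count_list xs m * m" for m
  proof (cases "odd m")
    case True
    then show ?thesis
      by (simp add: glaisher_block_def sum_list_mult_const binary)
  next
    case False
    then have "count_list xs m = 0" using assms by (auto simp: count_list_0_iff)
    then show ?thesis using False by (simp add: glaisher_block_def)
  qed
  have "set xs \<subseteq> {0..<Suc (sum_list xs)}" using part_le_sum_list by (auto simp: less_Suc_eq_le)
  then have "sum_list (map id xs) = (\<Sum>m\<in>{0..<Suc (sum_list xs)}. count_list xs m * m)"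
    by (subst sum_list_map_eq_sum_count2) auto
  moreover have "sum_list (glaisher xs) = (\<Sum>m\<leftarrow>[0..<Suc (sum_list xs)]. count_list xs m * m)"
  proof -
    have "sum_list (concat (map f ms)) = (\<Sum>m\<leftarrow>ms. sum_list (f m))" for f :: "nat \<Rightarrow> nat list" and ms
      by (induction ms) auto
    then show ?thesis by (simp only: glaisher_eq_blocks sum_list_reorder block)
  qed
  ultimately show ?thesis
    by (simp only: interv_sum_list_conv_sum_set_nat list.map_id set_upt)
qed

lemma count_list_descends: "sorted_wrt descends xs \<Longrightarrow> odd x \<Longrightarrow> count_list xs x = of_bool (x \<in> set xs)"
  by (induction xs) (auto simp: count_list_0_iff)

text \<open>The binary digits give \<open>b\<^sub>m + 2 * b\<^sub>2\<^sub>m\<close> for each odd \<open>m\<close>; since the odd part \<open>m\<close> is not repeated,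
  \<open>b\<^sub>m\<close> is the parity of this number. No other parts occur because none is divisible by 4.\<close>

lemma glaisher_psi_inv_inject:
  assumes "sorted_wrt descends xs" "\<forall>x\<in>set xs. \<not> 4 dvd x"
    "sorted_wrt descends ys" "\<forall>x\<in>set ys. \<not> 4 dvd x"
    "glaisher (psi_inv xs) = glaisher (psi_inv ys)"
  shows "xs = ys"
proof -
  have eq: "count_list xs m + 2 * count_list xs (2 * m) = count_list ys m + 2 * count_list ys (2 * m)"
    if "odd m" for m
  proof -
    have "count_list (psi_inv xs) m = count_list (psi_inv ys) m"
      using assms(5) power_mult_mem_glaisher_iff[OF that] by (intro bit_eqI) metis
    then show ?thesis using that by (simp add: count_list_psi_inv)
  qed
  have odd: "count_list xs m = count_list ys m" if "odd m" for m
    using arg_cong[OF eq[OF that], of even]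
    by (auto simp: count_list_descends[OF assms(1) that] count_list_descends[OF assms(3) that])
  have "count_list xs x = count_list ys x" for x
  proof -
    consider "odd x" | m where "x = 2 * m" "odd m" | "4 dvd x"
    proof (cases "odd x")
      case False
      then obtain m where m: "x = 2 * m" by blast
      then show ?thesis using that by (cases "odd m") auto
    qed (use that in blast)
    then show ?thesis
    proof cases
      case 2
      then show ?thesis using eq[OF 2(2)] odd[OF 2(2)] by simp
    next
      case 3
      then have "x \<notin> set xs" "x \<notin> set ys" using assms(2,4) by auto
      then show ?thesis by simp
    qed (rule odd)
  qed
  then have "mset xs = mset ys" by (intro multiset_eqI) (simp add: count_mset)
  then show ?thesis
    using sorted_desc_eqI sorted_desc_if_descends assms(1,3) by blast
qed

text \<open>An odd part of the image is an odd \<open>m\<close> with lowest binary digit 1, that is, with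
  \<open>b\<^sub>m + 2 * b\<^sub>2\<^sub>m\<close> odd, that is, with \<open>b\<^sub>m = 1\<close>. So both partitions have the same odd parts.\<close>

lemma count_residue_glaisher_psi_inv:
  assumes "sorted_wrt descends xs" "odd a"
  shows "length (filter (\<lambda>x. x mod 4 = a) (glaisher (psi_inv xs))) =
    length (filter (\<lambda>x. x mod 4 = a) xs)"
proof -
  let ?f = "filter (\<lambda>x. x mod 4 = a)"
  have odd: "odd x" if "x mod 4 = a" for x using that assms(2) by presburger
  have "x \<in> set (glaisher (psi_inv xs)) \<longleftrightarrow> x \<in> set xs" if "odd x" for x
    using power_mult_mem_glaisher_iff[OF that, of 0 "psi_inv xs"] that
    by (simp add: bit_0 count_list_psi_inv count_list_descends[OF assms(1)])
  then have set: "set (?f (glaisher (psi_inv xs))) = set (?f xs)" using odd by auto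
  have "distinct (?f xs)"
    using assms(1)
  proof (induction xs)
    case (Cons x xs)
    then have "x \<notin> set xs" if "x mod 4 = a" using odd[OF that] by auto
    then show ?case using Cons by auto
  qed simp
  then show ?thesis
    using set distinct_glaisher[of "psi_inv xs"] by (metis distinct_card distinct_filter)
qed

section \<open>The composite map\<close>

lemma finite_strict_partitions: "finite (strict_partitions n)"
proof (rule finite_subset)
  show "strict_partitions n \<subseteq> {xs. set xs \<subseteq> {..n} \<and> distinct xs}"
    using part_le_sum_list by (auto simp: strict_partitions_def partitions_def)
  show "finite {xs. set xs \<subseteq> {..n} \<and> distinct xs}"
    by (rule finite_subset_distinct) simp
qed

theorem theorem2p18:
  fixes n i j :: nat
  shows "F_map ` strict_partitions n \<subseteq> strict_partitions n
    \<and> bij_betw F_map (D_e n i j) (D_r n i j)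
    \<and> card (D_e n i j) = card (D_r n i j)"
proof -
  let ?D = "strict_partitions n"
  have D: "distinct xs" "sorted_wrt (\<ge>) xs" "0 \<notin> set xs" "sum_list xs = n" if "xs \<in> ?D" for xs
    using that by (auto simp: strict_partitions_def partitions_def is_partition_def)
  have F: "F_map xs = glaisher (psi_inv (Phi_map (phi_map xs)))" for xs
    by (simp add: F_map_def)
  have chain: "tight_chain (phi_map xs)" if "xs \<in> ?D" for xs
    using tight_chain_phi_map D(1)[OF that] .
  note Phi = Phi_map_spec[OF chain]
  have maps: "F_map xs \<in> ?D" if "xs \<in> ?D" for xs
  proof -
    have odd: "\<forall>x\<in>set (psi_inv ys). odd x" for ys by (auto simp: psi_inv_def)
    have "sum_list (F_map xs) = n"
      unfolding F sum_list_glaisher[OF odd] sum_list_psi_inv[OF Phi(3)[OF that]]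
      by (simp add: Phi(1)[OF that] sum_list_phi_map D(4)[OF that])
    moreover have "sorted_wrt (\<ge>) (F_map xs)" unfolding F glaisher_def by (rule sorted_reorder)
    moreover have "distinct (F_map xs)" unfolding F by (rule distinct_glaisher)
    moreover have "\<forall>x\<in>set (F_map xs). 0 < x" by (auto simp: F set_glaisher odd_pos)
    ultimately show ?thesis by (simp add: strict_partitions_def partitions_def is_partition_def)
  qed
  have inj: "inj_on F_map ?D"
  proof (rule inj_onI)
    fix xs ys assume xs: "xs \<in> ?D" and ys: "ys \<in> ?D" and eq: "F_map xs = F_map ys"
    from eq have "Phi_map (phi_map xs) = Phi_map (phi_map ys)"
      unfolding F
      by (rule glaisher_psi_inv_inject[OF Phi(2)[OF xs] Phi(3)[OF xs] Phi(2)[OF ys] Phi(3)[OF ys]])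
    then have "phi_map xs = phi_map ys" by (rule Phi_map_inject[OF chain[OF xs] chain[OF ys]])
    then show "xs = ys"
      by (rule strict_phi_map_inject[OF D(1)[OF xs] D(1)[OF ys] D(2)[OF xs] D(2)[OF ys]
            D(3)[OF xs] D(3)[OF ys]])
  qed
  \<comment> \<open>An injection of the finite set \<open>\<D>(n)\<close> into itself is onto.\<close>
  have onto: "F_map ` ?D = ?D"
    using endo_inj_surj[OF finite_strict_partitions _ inj] maps by blast
  have residues: "residue_count a (F_map xs) = residue_count a (phi_map xs)"
    if "xs \<in> ?D" "odd a" "a < 4" for xs a
    using that Phi(4)[OF that(1), of a] count_residue_glaisher_psi_inv[OF Phi(2)[OF that(1)] that(2)]
    by (simp add: residue_count_conv_filter F odd_pos)
  have stats: "residue_count 1 (F_map xs) = e1 xs" "residue_count 3 (F_map xs) = e3 xs" if "xs \<in> ?D" for xs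
    using residues[OF that] residue_count_phi_map[OF D(1,2)[OF that]] by (simp_all add: e1_def e3_def)
  have bij: "bij_betw F_map (D_e n i j) (D_r n i j)"
  proof (rule bij_betw_imageI)
    show "inj_on F_map (D_e n i j)" by (rule inj_on_subset[OF inj]) (auto simp: D_e_def)
    show "F_map ` D_e n i j = D_r n i j"
    proof -
      have "F_map xs \<in> D_r n i j \<longleftrightarrow> xs \<in> D_e n i j" if "xs \<in> ?D" for xs
        using maps[OF that] that unfolding D_e_def D_r_def by (simp only: mem_Collect_eq stats[OF that])
      moreover have "D_r n i j \<subseteq> F_map ` ?D" unfolding onto by (auto simp: D_r_def)
      moreover have "D_e n i j \<subseteq> ?D" by (auto simp: D_e_def)
      ultimately show ?thesis by blast
    qed
  qed
  show ?thesis using onto bij bij_betw_same_card[OF bij] by simp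
qed

end
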